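(* Let $\ell\ge3$ be odd. Then $C(W,\ell)\le1$ for every tournamenton $W$, and equality holds if and only if $W$ is regular. In particular, $c(\ell)=1$.
   Context: A tournamenton is a measurable $W:[0,1]^2\to[0,1]$ with $W(x,y)+W(y,x)=1$ for all $x,y$; it is regular if $\int_0^1W(x,y)\,dy=1/2$ for almost every $x$. $C(W,\ell)=2^{\ell}\int_{[0,1]^\ell}W(x_1,x_2)W(x_2,x_3)\cdots W(x_{\ell-1},x_\ell)W(x_\ell,x_1)\,dx_1\cdots dx_\ell$. For $n\ge\ell$, $C(n,\ell)$ is the maximum number of directed cycles of length $\ell$ in an $n$-vertex tournament, $R(n,\ell)=\frac{(\ell-1)!}{2^\ell}\binom n\ell$, and $c(\ell)=\lim_{n\to\infty}C(n,\ell)/R(n,\ell)$; equivalently $c(\ell)$ is the maximum of $C(W,\ell)$ over all tournamentons $W$. *)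

theory Defs
  imports "HOL-Analysis.Analysis"
begin

definition tournamenton :: "(real \<Rightarrow> real \<Rightarrow> real) \<Rightarrow> bool" where
  "tournamenton W \<longleftrightarrow>
     (\<lambda>(x, y). W x y) \<in> borel_measurable (lebesgue_on ({0..1} \<times> {0..1})) \<and>
     (\<forall>x\<in>{0..1}. \<forall>y\<in>{0..1}. W x y \<in> {0..1} \<and> W x y + W y x = 1)"

definition regular_tournamenton :: "(real \<Rightarrow> real \<Rightarrow> real) \<Rightarrow> bool" where
  "regular_tournamenton W \<longleftrightarrow>
     (AE x in lebesgue_on {0..1}. (LINT y|lebesgue_on {0..1}. W x y) = 1 / 2)"

text \<open>Lebesgue measure on the cube of dimension \<open>l\<close>, with coordinates indexed by \<open>{..<l}\<close>.
  The completion is needed because tournamentons are only Lebesgue measurable, and the integrand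
  of the cycle density need not be measurable for the product sigma-algebra itself.\<close>

definition unit_cube_measure :: "nat \<Rightarrow> (nat \<Rightarrow> real) measure" where
  "unit_cube_measure l = completion (Pi\<^sub>M {..<l} (\<lambda>_. restrict_space lborel {0..1}))"

definition cycle_density :: "(real \<Rightarrow> real \<Rightarrow> real) \<Rightarrow> nat \<Rightarrow> real" where
  "cycle_density W l =
     2 ^ l * (LINT x|unit_cube_measure l. (\<Prod>i<l. W (x i) (x (Suc i mod l))))"

definition tournament :: "'a set \<Rightarrow> ('a \<times> 'a) set \<Rightarrow> bool" where
  "tournament V E \<longleftrightarrow> E \<subseteq> V \<times> V \<and> asym E \<and> total_on V E"

text \<open>A directed cycle is a subgraph, identified with its arc set, so that the \<open>l\<close> rotations of
  a cyclic sequence of vertices count as one cycle.\<close>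

definition directed_cycles :: "('a \<times> 'a) set \<Rightarrow> nat \<Rightarrow> ('a \<times> 'a) set set" where
  "directed_cycles E l =
     {(\<lambda>i. (v i, v (Suc i mod l))) ` {..<l} | v.
        inj_on v {..<l} \<and> (\<forall>i<l. (v i, v (Suc i mod l)) \<in> E)}"

definition max_cycles :: "nat \<Rightarrow> nat \<Rightarrow> nat" where
  "max_cycles n l = Max {card (directed_cycles E l) | E. tournament {..<n} E}"

definition random_cycles :: "nat \<Rightarrow> nat \<Rightarrow> real" where
  "random_cycles n l = fact (l - 1) / 2 ^ l * real (n choose l)"

definition cycle_constant :: "nat \<Rightarrow> real" where
  "cycle_constant l = lim (\<lambda>n. real (max_cycles n l) / random_cycles n l)"

end

theory Submission
  imports Defs "Jordan_Normal_Form.Schur_Decomposition" "HOL-Probability.Probability"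
    "HOL-Real_Asymp.Real_Asymp"
begin

text \<open>
  Write \<open>2 W = J + B\<close> with \<open>J\<close> the constant kernel 1 and \<open>B\<close> skew-symmetric, \<open>\<bar>B\<bar> \<le> 1\<close>. For odd \<open>l\<close> the
  trace of \<open>B^l\<close> vanishes, and therefore \<open>C(W, l) = tr ((J + B)^l)\<close> is a polynomial in the moments
  \<open>\<langle>1, B^k 1\<rangle>\<close>, \<open>k < l\<close>. These moments are also those of an \<open>l \<times> l\<close> real skew-symmetric matrix \<open>T\<close>,
  the compression of \<open>B\<close> to the span of \<open>1, B 1, B^2 1, \<dots>\<close>, with Hilbert--Schmidt norm at most 1.
  The eigenvalues \<open>z\<close> of \<open>e\<^sub>0 e\<^sub>0\<^sup>T + T\<close> have nonnegative real parts with sum 1, and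
  \<open>(Im z)\<^sup>2 \<le> 1/2\<close>; the nonreal ones come in conjugate pairs, so that their real parts are at most
  \<open>1/2\<close>. These constraints give \<open>Re (z^l) \<le> Re z\<close> for every odd \<open>l \<ge> 3\<close> except 5, and summing over the
  eigenvalues yields \<open>C(W, l) \<le> 1\<close>. Equality forces the eigenvalue 1, whose eigenvector must be \<open>e\<^sub>0\<close>,
  that is, \<open>B 1 = 0\<close>. For \<open>l = 5\<close> the polynomial is \<open>1 - 5 \<parallel>B 1\<parallel>\<^sup>2 + 5 \<parallel>B (B 1)\<parallel>\<^sup>2\<close>.

  For \<open>c(l) = 1\<close>, the number of cycles in a tournament is bounded by the density of its step
  tournamenton, while the average over all tournaments on \<open>n\<close> vertices is exactly \<open>R(n, l)\<close>.
\<close>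

section \<open>Odd powers near the imaginary axis\<close>

text \<open>The operator \<open>B\<close> lives on an infinite-dimensional space, so its trace
  cannot be read off a finite compression. What helps is that J has rank one: expanding (J + B)^l
  one factor at a time leaves only moments and the trace of B^l, and skew symmetry kills the latter
  separately for the kernel and for the matrix. Both traces are thus the same polynomial
  \<open>cycle_moment\<close>, and eigenvalues are needed for matrices only.

  The bound 1/2 comes from skew symmetry: the eigenvalues of a skew matrix pair up with opposite
  signs, so each counts twice in the Hilbert-Schmidt norm. Near iy the real part of z^l is to first
  order l (iy)^(l-1) Re z. At y^2 = 1/2 the factor has modulus 3/2, 5/4, 7/8 for l = 3, 5, 7 and
  decreases afterwards; it is negative for l = 3, so only l = 5 escapes.

  Traces and sections evaluate kernels on sets that may be null. Hence the kernel calculus uses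
  bounds and identities valid at every point, and a tournamenton is first replaced by a Borel
  version that is a tournamenton everywhere.\<close>

text \<open>Odd powers map the imaginary axis to itself, so the real part is controlled by the
  distance to that axis, with the modulus of the derivative as factor. The induction multiplies by
  z^2, whose imaginary part carries the factor Re z.\<close>

lemma abs_Re_odd_power_le:
  fixes z :: complex
  shows "\<bar>Re (z ^ (2 * k + 1))\<bar> \<le> real (2 * k + 1) * \<bar>Re z\<bar> * cmod z ^ (2 * k)"
proof (induction k)
  case 0
  then show ?case by simp
next
  case (Suc k)
  let ?w = "z ^ (2 * k + 1)"
  have eq: "z ^ (2 * Suc k + 1) = z\<^sup>2 * ?w"
    by (simp add: power2_eq_square)
  have re2: "\<bar>Re (z\<^sup>2)\<bar> \<le> cmod z ^ 2"
    using abs_Re_le_cmod[of "z\<^sup>2"] by (simp add: norm_power)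
  have im2: "\<bar>Im (z\<^sup>2)\<bar> \<le> 2 * \<bar>Re z\<bar> * cmod z"
    using mult_left_mono[OF abs_Im_le_cmod[of z], of "2 * \<bar>Re z\<bar>"]
    by (simp add: power2_eq_square abs_mult mult.commute)
  have imw: "\<bar>Im ?w\<bar> \<le> cmod z ^ (2 * k + 1)"
    using abs_Im_le_cmod[of ?w] by (simp only: norm_power)
  have "\<bar>Re (z ^ (2 * Suc k + 1))\<bar> \<le> \<bar>Re (z\<^sup>2)\<bar> * \<bar>Re ?w\<bar> + \<bar>Im (z\<^sup>2)\<bar> * \<bar>Im ?w\<bar>"
    unfolding eq times_complex.sel by (metis abs_mult abs_triangle_ineq4)
  also have "\<dots> \<le> cmod z ^ 2 * (real (2 * k + 1) * \<bar>Re z\<bar> * cmod z ^ (2 * k))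
      + (2 * \<bar>Re z\<bar> * cmod z) * cmod z ^ (2 * k + 1)"
    by (intro add_mono mult_mono re2 im2 imw Suc.IH) auto
  also have "\<dots> = real (2 * Suc k + 1) * \<bar>Re z\<bar> * cmod z ^ (2 * Suc k)"
    by (simp add: algebra_simps power2_eq_square)
  finally show ?case .
qed

text \<open>The base is (3/20)^2 + 1/2, the bound on the squared modulus when Re z <= 3/20. The
  cut-off 3/20 is almost the largest possible: 7 * (209/400)^3 is barely below 1.\<close>

lemma odd_times_power_less_one:
  fixes k :: nat
  assumes "k \<ge> 3"
  shows "real (2 * k + 1) * (209 / 400) ^ k < 1"
  using assms
proof (induction k rule: dec_induct)
  case base
  then show ?case by (simp add: power3_eq_cube)
next
  case (step k)
  have "real (2 * Suc k + 1) * (209 / 400) ^ Suc k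
      = (real (2 * k + 3) * (209 / 400)) * (209 / 400) ^ k" by (simp add: mult_ac)
  also have "\<dots> \<le> real (2 * k + 1) * (209 / 400) ^ k"
    by (rule mult_right_mono) (use step.hyps in auto)
  finally show ?case using step.IH by linarith
qed

text \<open>Near the imaginary axis the linear bound on the real part of a power is used, away from it
  the modulus bound. The exponent 5 must be excluded: there \<open>Re (z ^ 5)\<close> is about
  \<open>5/4 * Re z\<close> close to \<open>\<i> / sqrt 2\<close>.\<close>

lemma Re_odd_power_less_Re:
  fixes z :: complex
  assumes l: "odd l" "l \<ge> 3" "l \<noteq> 5" and x: "0 < Re z" "Re z \<le> 1 / 2" and y: "(Im z)\<^sup>2 \<le> 1 / 2"
  shows "Re (z ^ l) < Re z"
proof (cases "l = 3")
  case True
  have "Re (z ^ 3) = Re z * ((Re z)\<^sup>2 - 3 * (Im z)\<^sup>2)"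
    by (simp add: power3_eq_cube power2_eq_square algebra_simps)
  also have "\<dots> < Re z * 1"
  proof (rule mult_strict_left_mono)
    have "(Re z)\<^sup>2 \<le> (1/2)\<^sup>2" using x by (intro power_mono) auto
    then show "(Re z)\<^sup>2 - 3 * (Im z)\<^sup>2 < 1"
      using zero_le_power2[of "Im z"] unfolding power2_eq_square by linarith
  qed (use x in auto)
  finally show ?thesis using True by simp
next
  case False
  with l have l7: "l \<ge> 7" by presburger
  from l obtain k where k: "l = 2 * k + 1" by (auto elim: oddE)
  have k3: "k \<ge> 3" using l7 k by simp
  have mod2: "cmod z ^ 2 = (Re z)\<^sup>2 + (Im z)\<^sup>2" by (simp add: cmod_power2)
  show ?thesis
  proof (cases "Re z \<le> 3 / 20")
    case True
    have "(Re z)\<^sup>2 \<le> (3 / 20)\<^sup>2" using True x by (intro power_mono) auto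
    then have "cmod z ^ 2 \<le> 209 / 400" using mod2 y by (simp add: power2_eq_square)
    then have "cmod z ^ (2 * k) \<le> (209 / 400) ^ k"
      by (simp add: power_mult power_mono)
    have "Re (z ^ l) \<le> real (2 * k + 1) * Re z * cmod z ^ (2 * k)"
      using abs_Re_odd_power_le[of z k] x unfolding k by simp
    also have "\<dots> \<le> real (2 * k + 1) * Re z * (209 / 400) ^ k"
      using \<open>cmod z ^ (2 * k) \<le> _\<close> x by (intro mult_left_mono) auto
    also have "\<dots> = Re z * (real (2 * k + 1) * (209 / 400) ^ k)" by simp
    also have "\<dots> < Re z * 1"
      using odd_times_power_less_one[OF k3] x by (intro mult_strict_left_mono) auto
    finally show ?thesis by simp
  next
    case False
    define t where "t = (Re z)\<^sup>2"
    have t1: "9 / 400 \<le> t" unfolding t_def using power_mono[of "3/20" "Re z" 2] False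
      by (simp add: power2_eq_square)
    have t2: "t \<le> 1 / 4" unfolding t_def using power_mono[of "Re z" "1/2" 2] x
      by (simp add: power2_eq_square)
    have c2: "cmod z ^ 2 \<le> t + 1 / 2" using mod2 y t_def by simp
    then have "cmod z ^ 2 \<le> 1\<^sup>2" using t2 by simp
    then have c1: "cmod z \<le> 1" by (rule power2_le_imp_le) simp
    text \<open>\<open>(t + 1/2)^7\<close> is convex, so it suffices to compare it with \<open>t\<close> at the end points.\<close>
    have "(t + 1 / 2) ^ 7 < t"
    proof -
      \<comment> \<open>The convex coordinate of \<open>t\<close> between the end points 1/4 and
        9/400, which are 91/400 apart.\<close>
      define a where "a = (1/4 - t) / (91/400)"
      have a01: "0 \<le> a" "a \<le> 1" using t1 t2 by (auto simp: a_def field_simps)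
      have "convex_on {0..} (\<lambda>u::real. u ^ 7)" by (rule convex_power_odd) simp
      then have "((1 - a) *\<^sub>R (3/4) + a *\<^sub>R (209/400)) ^ 7
          \<le> (1 - a) * (3/4) ^ 7 + a * (209/400::real) ^ 7"
        by (rule convex_onD) (use a01 in auto)
      moreover have "(1 - a) *\<^sub>R (3/4) + a *\<^sub>R (209/400) = t + 1/2"
        by (simp add: a_def field_simps)
      \<comment> \<open>The constants 7/50 and 2/100 round up (3/4)^7 and (209/400)^7 and still lie
        below the corresponding end points 1/4 and 9/400 of \<open>t\<close>.\<close>
      moreover have "(1 - a) * (3/4) ^ 7 + a * (209/400::real) ^ 7 \<le> (1 - a) * (7/50) + a * (2/100)"
        using a01 by (intro add_mono mult_left_mono) (simp_all add: eval_nat_numeral)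
      moreover have "(1 - a) * (7/50) + a * (2/100) < t"
        using a01 by (simp add: a_def field_simps)
      ultimately show ?thesis by simp
    qed
    moreover have "(cmod z ^ 7)\<^sup>2 \<le> (t + 1 / 2) ^ 7"
      using power_mono[OF c2, of 7] by (simp add: power_mult[symmetric] mult.commute)
    ultimately have "(cmod z ^ 7)\<^sup>2 < (Re z)\<^sup>2" unfolding t_def by simp
    then have "cmod z ^ 7 < Re z" by (rule power2_less_imp_less) (use x in simp)
    moreover have "cmod z ^ l \<le> cmod z ^ 7" using l7 c1 by (intro power_decreasing) auto
    moreover have "Re (z ^ l) \<le> cmod z ^ l" using complex_Re_le_cmod[of "z ^ l"] by (simp add: norm_power)
    ultimately show ?thesis by linarith
  qed
qed

text \<open>Real eigenvalues may lie anywhere in [0, 1]; the bound 1/2 is available for nonreal ones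
  only. Off the real line the inequality is strict unless Re z = 0, and on it r^l = r leaves only 0
  and 1.\<close>

lemma Re_odd_power_le_Re:
  fixes z :: complex
  assumes l: "odd l" "l \<ge> 3" "l \<noteq> 5" and x: "0 \<le> Re z" "Re z \<le> 1" and y: "(Im z)\<^sup>2 \<le> 1 / 2"
    and nr: "Im z \<noteq> 0 \<Longrightarrow> Re z \<le> 1 / 2"
  shows "Re (z ^ l) \<le> Re z" and "Re (z ^ l) = Re z \<Longrightarrow> Re z > 0 \<Longrightarrow> z = 1"
proof -
  have real_case: "Re (z ^ l) = Re z ^ l" if "Im z = 0"
  proof -
    have "z = of_real (Re z)" using that by (simp add: complex_eq_iff)
    then show ?thesis by (metis Re_complex_of_real of_real_power)
  qed
  have imag_case: "Re (z ^ l) = 0" if "Re z = 0"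
  proof -
    from l obtain k where k: "l = 2 * k + 1" by (auto elim: oddE)
    show ?thesis using abs_Re_odd_power_le[of z k] that k by simp
  qed
  have dec: "r ^ l < r" if "0 < r" "r < 1" for r :: real
    using power_strict_decreasing[of 1 l r] that l by simp
  show "Re (z ^ l) \<le> Re z"
  proof (cases "Im z = 0")
    case True
    then show ?thesis using real_case power_decreasing[of 1 l "Re z"] x l by simp
  next
    case False
    then show ?thesis
      using Re_odd_power_less_Re[OF l] x y nr imag_case by (cases "Re z = 0") force+
  qed
  assume "Re (z ^ l) = Re z" "Re z > 0"
  moreover from this have "Im z = 0"
    using Re_odd_power_less_Re[OF l] y nr by force
  ultimately show "z = 1" using real_case dec[of "Re z"] x by (force simp: complex_eq_iff)
qed

section \<open>Traces of bordered skew-symmetric matrices\<close>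

definition mat_trace :: "'a::comm_monoid_add mat \<Rightarrow> 'a" where
  "mat_trace A = (\<Sum>i<dim_row A. A $$ (i, i))"

lemma index_mult_mat_sum:
  assumes "A \<in> carrier_mat n m" "B \<in> carrier_mat m p" "i < n" "j < p"
  shows "(A * B) $$ (i, j) = (\<Sum>k<m. A $$ (i, k) * B $$ (k, j))"
  using assms by (auto simp: scalar_prod_def lessThan_atLeast0 intro!: sum.cong)

lemma mat_trace_comm:
  fixes A :: "'a::comm_semiring_0 mat"
  assumes A: "A \<in> carrier_mat n m" and B: "B \<in> carrier_mat m n"
  shows "mat_trace (A * B) = mat_trace (B * A)"
proof -
  have "mat_trace (A * B) = (\<Sum>i<n. \<Sum>k<m. A $$ (i, k) * B $$ (k, i))"
    unfolding mat_trace_def using A B by (auto intro!: sum.cong simp: index_mult_mat_sum[OF A B] simp del: index_mult_mat(1))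
  also have "\<dots> = (\<Sum>k<m. \<Sum>i<n. B $$ (k, i) * A $$ (i, k))"
    by (subst sum.swap) (simp add: mult.commute)
  also have "\<dots> = mat_trace (B * A)"
    unfolding mat_trace_def using A B by (auto intro!: sum.cong simp: index_mult_mat_sum[OF B A] simp del: index_mult_mat(1))
  finally show ?thesis .
qed

lemma mat_trace_add:
  assumes "A \<in> carrier_mat n n" "B \<in> carrier_mat n n"
  shows "mat_trace (A + B) = mat_trace A + mat_trace B"
  using assms by (simp add: mat_trace_def sum.distrib)

lemma pow_mat_Suc_left:
  fixes A :: "'a::semiring_1 mat"
  assumes A: "A \<in> carrier_mat n n"
  shows "A ^\<^sub>m Suc k = A * A ^\<^sub>m k"
proof (induction k)
  case 0
  then show ?case using A by simp
next
  case (Suc k)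
  have "A ^\<^sub>m Suc (Suc k) = A * A ^\<^sub>m k * A" using Suc by simp
  also have "\<dots> = A * A ^\<^sub>m Suc k"
    using A by (simp add: assoc_mult_mat[OF A pow_carrier_mat[OF A] A])
  finally show ?case .
qed

lemma upper_triangular_mult:
  fixes A B :: "'a::semiring_0 mat"
  assumes A: "A \<in> carrier_mat n n" "upper_triangular A" and B: "B \<in> carrier_mat n n" "upper_triangular B"
  shows "upper_triangular (A * B)" and "i < n \<Longrightarrow> (A * B) $$ (i, i) = A $$ (i, i) * B $$ (i, i)"
proof -
  show "upper_triangular (A * B)"
  proof (rule upper_triangularI)
    fix i j assume "j < i" "i < dim_row (A * B)"
    with A B have ij: "i < n" "j < n" by auto
    have "A $$ (i, k) * B $$ (k, j) = 0" if "k < n" for k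
    proof (cases "k < i")
      case True
      then show ?thesis using A ij upper_triangularD[of A k i] by auto
    next
      case False
      then show ?thesis using B that \<open>j < i\<close> upper_triangularD[of B j k] by auto
    qed
    then show "(A * B) $$ (i, j) = 0"
      unfolding index_mult_mat_sum[OF A(1) B(1) ij] by (intro sum.neutral) auto
  qed
  assume i: "i < n"
  have "A $$ (i, k) * B $$ (k, i) = 0" if "k < n" "k \<noteq> i" for k
  proof (cases "k < i")
    case True
    then show ?thesis using A i upper_triangularD[of A k i] by auto
  next
    case False
    then show ?thesis using B that upper_triangularD[of B i k] by auto
  qed
  then have "(\<Sum>k<n. A $$ (i, k) * B $$ (k, i)) = (\<Sum>k\<in>{i}. A $$ (i, k) * B $$ (k, i))"
    using i by (intro sum.mono_neutral_right) auto
  then show "(A * B) $$ (i, i) = A $$ (i, i) * B $$ (i, i)"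
    unfolding index_mult_mat_sum[OF A(1) B(1) i i] by simp
qed

lemma upper_triangular_pow:
  fixes A :: "'a::semiring_1 mat"
  assumes A: "A \<in> carrier_mat n n" "upper_triangular A"
  shows "upper_triangular (A ^\<^sub>m k) \<and> (\<forall>i<n. (A ^\<^sub>m k) $$ (i, i) = A $$ (i, i) ^ k)"
proof (induction k)
  case 0
  then show ?case using A by (auto intro!: upper_triangularI)
next
  case (Suc k)
  then show ?case
    using upper_triangular_mult[OF pow_carrier_mat[OF A(1)] _ A, of k]
    by (auto simp: power_commutes simp del: index_mult_mat(1))
qed

text \<open>Schur's triangular form shows the eigenvalues with algebraic multiplicity on its
  diagonal, and powers act entrywise there. Triangularization is used because a bordered skew matrix
  need not be normal.\<close>

lemma mat_trace_pow_eigenvalues: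
  fixes A :: "complex mat"
  assumes A: "A \<in> carrier_mat n n" and es: "char_poly A = (\<Prod>e\<leftarrow>es. [:- e, 1:])"
  shows "mat_trace (A ^\<^sub>m k) = (\<Sum>e\<leftarrow>es. e ^ k)"
proof -
  obtain B P Q where dec: "schur_decomposition A es = (B, P, Q)" by (metis prod_cases3)
  from schur_decomposition[OF A es dec]
  have sim: "similar_mat_wit A B P Q" and ut: "upper_triangular B" and diag: "diag_mat B = es" by auto
  from similar_mat_witD2[OF A sim] have
    carr: "B \<in> carrier_mat n n" "P \<in> carrier_mat n n" "Q \<in> carrier_mat n n" and QP: "Q * P = 1\<^sub>m n" by auto
  have Bk: "B ^\<^sub>m k \<in> carrier_mat n n" using carr by simp
  have "mat_trace (A ^\<^sub>m k) = mat_trace (P * (B ^\<^sub>m k * Q))"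
    using similar_mat_wit_pow_id[OF sim, of k] assoc_mult_mat[OF carr(2) Bk carr(3)] by simp
  also have "\<dots> = mat_trace (B ^\<^sub>m k * Q * P)"
    by (rule mat_trace_comm[OF carr(2) mult_carrier_mat[OF Bk carr(3)]])
  also have "B ^\<^sub>m k * Q * P = B ^\<^sub>m k"
    using assoc_mult_mat[OF Bk carr(3,2)] QP right_mult_one_mat[OF Bk] by simp
  also have "mat_trace (B ^\<^sub>m k) = (\<Sum>i<n. B $$ (i, i) ^ k)"
    unfolding mat_trace_def using upper_triangular_pow[OF carr(1) ut, of k] Bk by auto
  also have "\<dots> = (\<Sum>e\<leftarrow>es. e ^ k)"
    using carr unfolding diag[symmetric] diag_mat_def
    by (simp add: sum_list_sum_nth lessThan_atLeast0)
  finally show ?thesis .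
qed

text \<open>With \<open>b i = \<langle>1, B^i 1\<rangle>\<close>, the number \<open>walk_moment b j i\<close> is \<open>\<langle>1, (J + B)^j B^i 1\<rangle>\<close>, where
  \<open>J\<close> is the orthogonal projection onto \<open>1\<close>, and \<open>cycle_moment b l\<close> is the trace of
  \<open>(J + B)^l\<close> minus that of \<open>B^l\<close>.\<close>

fun walk_moment :: "(nat \<Rightarrow> real) \<Rightarrow> nat \<Rightarrow> nat \<Rightarrow> real" where
  "walk_moment b 0 i = b i"
| "walk_moment b (Suc j) i = b i * walk_moment b j 0 + walk_moment b j (Suc i)"

definition cycle_moment :: "(nat \<Rightarrow> real) \<Rightarrow> nat \<Rightarrow> real" where
  "cycle_moment b l = (\<Sum>j<l. walk_moment b j (l - 1 - j))"

lemma walk_moment_cong: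
  "(\<And>k. k \<le> i + j \<Longrightarrow> b k = c k) \<Longrightarrow> walk_moment b j i = walk_moment c j i"
  by (induction j arbitrary: i) auto

lemma cycle_moment_cong:
  "(\<And>k. k < l \<Longrightarrow> b k = c k) \<Longrightarrow> cycle_moment b l = cycle_moment c l"
  unfolding cycle_moment_def by (intro sum.cong refl walk_moment_cong) auto

text \<open>A cyclic word in J and B contributes the product of the moments of its runs of B. With
  odd moments zero, the words of length 5 that survive are J^5, the five with one J, and the five
  with three J and the two B adjacent.\<close>

lemma cycle_moment_five:
  assumes "b 0 = 1" "b 1 = 0" "b 3 = 0"
  shows "cycle_moment b 5 = 1 + 5 * b 2 + 5 * b 4"
  using assms by (simp add: cycle_moment_def eval_nat_numeral algebra_simps)

text \<open>Only the word without any factor B survives. This gives the value 1 for regular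
  tournamentons.\<close>

lemma cycle_moment_trivial:
  assumes "b 0 = 1" "\<And>k. k > 0 \<Longrightarrow> b k = 0" "l > 0"
  shows "cycle_moment b l = 1"
proof -
  have pos: "walk_moment b j i = 0" if "i > 0" for i j
    using that by (induction j arbitrary: i) (auto simp: assms)
  have zero: "walk_moment b j 0 = 1" for j
    by (induction j) (auto simp: assms pos)
  have "cycle_moment b l = (\<Sum>j\<in>{l - 1}. walk_moment b j (l - 1 - j))"
    unfolding cycle_moment_def using assms by (intro sum.mono_neutral_right) (auto intro: pos)
  then show ?thesis by (simp add: zero)
qed

text \<open>The matrix of \<open>J + B\<close> in an orthonormal basis starting with \<open>1\<close>, where \<open>t\<close> is the
  matrix of \<open>B\<close>.\<close>

definition bordered :: "nat \<Rightarrow> (nat \<Rightarrow> nat \<Rightarrow> real) \<Rightarrow> real mat" where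
  "bordered n t = mat n n (\<lambda>(i, j). t i j + (if i = 0 \<and> j = 0 then 1 else 0))"

lemma bordered_carrier [simp]: "bordered n t \<in> carrier_mat n n"
  by (simp add: bordered_def)

text \<open>Transposition fixes the diagonal but negates an odd power of a skew matrix.\<close>

lemma mat_trace_skew_odd_pow:
  fixes T :: "real mat"
  assumes T: "T \<in> carrier_mat n n" "T\<^sup>T = - T" and l: "odd l"
  shows "mat_trace (T ^\<^sub>m l) = 0"
proof -
  have tp: "(T ^\<^sub>m k)\<^sup>T = (-1) ^ k \<cdot>\<^sub>m T ^\<^sub>m k" for k
  proof (induction k)
    case 0
    then show ?case using T by (auto intro!: eq_matI)
  next
    case (Suc k)
    have Tk: "T ^\<^sub>m k \<in> carrier_mat n n" using T by simp
    have "(T ^\<^sub>m Suc k)\<^sup>T = T\<^sup>T * (T ^\<^sub>m k)\<^sup>T"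
      by (simp only: pow_mat.simps transpose_mult[OF Tk T(1)])
    also have "\<dots> = - T * ((-1) ^ k \<cdot>\<^sub>m T ^\<^sub>m k)" using T(2) Suc by simp
    also have "\<dots> = (-1) ^ Suc k \<cdot>\<^sub>m (T * T ^\<^sub>m k)"
      using T Tk by (intro eq_matI) (auto simp: mult_smult_distrib uminus_mult_left_mat)
    also have "T * T ^\<^sub>m k = T ^\<^sub>m Suc k" using pow_mat_Suc_left[OF T(1)] by simp
    finally show ?case .
  qed
  have dim: "T ^\<^sub>m l \<in> carrier_mat n n" using T by simp
  have "(T ^\<^sub>m l) $$ (i, i) = 0" if "i < n" for i
  proof -
    have "(T ^\<^sub>m l) $$ (i, i) = (T ^\<^sub>m l)\<^sup>T $$ (i, i)"
      using carrier_matD[OF dim] carrier_matD[OF T(1)] that by simp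
    also have "\<dots> = - (T ^\<^sub>m l) $$ (i, i)" unfolding tp using carrier_matD[OF dim] carrier_matD[OF T(1)] that l by simp
    finally show ?thesis by simp
  qed
  then show ?thesis unfolding mat_trace_def using carrier_matD[OF dim] by auto
qed

text \<open>The factors of A^l are replaced by \<open>T\<close> one after another. Each replacement
  costs a term with a rank one factor \<open>E\<close>, which is a walk moment, and the final T^l
  has trace 0.\<close>

lemma mat_trace_bordered_pow:
  assumes n: "n > 0" and skew: "\<And>i j. i < n \<Longrightarrow> j < n \<Longrightarrow> t i j = - t j i" and l: "odd l"
  shows "mat_trace (bordered n t ^\<^sub>m l) = cycle_moment (\<lambda>k. (mat n n (\<lambda>(i, j). t i j) ^\<^sub>m k) $$ (0, 0)) l"
proof -
  define T where "T = mat n n (\<lambda>(i, j). t i j)"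
  define A where "A = bordered n t"
  define E where "E = mat n n (\<lambda>(i, j). if i = 0 \<and> j = 0 then 1 else (0::real))"
  have [simp]: "T \<in> carrier_mat n n" "A \<in> carrier_mat n n" "E \<in> carrier_mat n n"
    by (auto simp: T_def A_def E_def)
  have [simp]: "dim_row T = n" "dim_row A = n" "dim_row E = n" "dim_col T = n" "dim_col A = n" "dim_col E = n"
    by (auto simp: T_def A_def E_def bordered_def)
  have A_eq: "A = E + T" by (auto simp: A_def T_def E_def bordered_def)
  \<comment> \<open>\<open>E\<close> is the outer product of the basis vector 0 with itself: it
    splits an entry of a product into two entries and turns a trace into an entry.\<close>
  have E_entry: "(X * E * Y) $$ (0, 0) = X $$ (0, 0) * Y $$ (0, 0)"
    and E_trace: "mat_trace (X * E * Y) = (Y * X) $$ (0, 0)"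
    if X: "X \<in> carrier_mat n n" and Y: "Y \<in> carrier_mat n n" for X Y
  proof -
    have XE: "(X * E) $$ (i, j) = (if j = 0 then X $$ (i, 0) else 0)" if "i < n" "j < n" for i j
      unfolding index_mult_mat_sum[OF X \<open>E \<in> _\<close> that] using that n by (simp add: E_def if_distrib cong: if_cong)
    have XEY: "(X * E * Y) $$ (i, j) = X $$ (i, 0) * Y $$ (0, j)" if "i < n" "j < n" for i j
    proof -
      have "(X * E * Y) $$ (i, j) = (\<Sum>k<n. (X * E) $$ (i, k) * Y $$ (k, j))"
        by (rule index_mult_mat_sum) (use X Y that in auto)
      also have "\<dots> = (\<Sum>k<n. if k = 0 then X $$ (i, 0) * Y $$ (0, j) else 0)"
        by (intro sum.cong refl) (use XE that in auto)
      finally show ?thesis using n by simp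
    qed
    show "(X * E * Y) $$ (0, 0) = X $$ (0, 0) * Y $$ (0, 0)" using XEY n by blast
    have "mat_trace (X * E * Y) = (\<Sum>i<n. X $$ (i, 0) * Y $$ (0, i))"
      unfolding mat_trace_def using X XEY by simp
    then show "mat_trace (X * E * Y) = (Y * X) $$ (0, 0)"
      unfolding index_mult_mat_sum[OF Y X n n] by (simp add: mult.commute)
  qed
  have Tp [simp]: "T ^\<^sub>m k \<in> carrier_mat n n" and Ap [simp]: "A ^\<^sub>m k \<in> carrier_mat n n" for k
    by simp_all
  define b where "b k = (T ^\<^sub>m k) $$ (0, 0)" for k
  have split: "X * A * Y = X * E * Y + X * T * Y"
    if X: "X \<in> carrier_mat n n" and Y: "Y \<in> carrier_mat n n" for X Y
  proof -
    have "X * A = X * E + X * T" unfolding A_eq using X by (intro mult_add_distrib_mat[of _ n n _ n]) auto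
    then show ?thesis using X Y by (simp add: add_mult_distrib_mat[of _ n n])
  qed
  \<comment> \<open>In the leftmost \<open>A\<close> of the power, the part \<open>E\<close> ends
    the initial run of \<open>T\<close> and starts a new walk, while the part \<open>T\<close>
    lengthens the run.\<close>
  have walk: "(T ^\<^sub>m i * A ^\<^sub>m j) $$ (0, 0) = walk_moment b j i" for i j
  proof (induction j arbitrary: i)
    case 0
    then show ?case using right_mult_one_mat[OF Tp[of i]] by (simp add: b_def)
  next
    case (Suc j)
    have "T ^\<^sub>m i * A ^\<^sub>m Suc j = T ^\<^sub>m i * A * A ^\<^sub>m j"
      unfolding pow_mat_Suc_left[OF \<open>A \<in> _\<close>] by (rule assoc_mult_mat[symmetric, of _ n n _ n _ n]) auto
    also have "\<dots> = T ^\<^sub>m i * E * A ^\<^sub>m j + T ^\<^sub>m Suc i * A ^\<^sub>m j"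
      using split[of "T ^\<^sub>m i" "A ^\<^sub>m j"] by simp
    finally have "(T ^\<^sub>m i * A ^\<^sub>m Suc j) $$ (0, 0)
        = (T ^\<^sub>m i * E * A ^\<^sub>m j) $$ (0, 0) + (T ^\<^sub>m Suc i * A ^\<^sub>m j) $$ (0, 0)"
      using n Tp Ap by (simp del: index_mult_mat(1) pow_mat.simps)
    moreover have "(A ^\<^sub>m j) $$ (0, 0) = walk_moment b j 0"
      using Suc[of 0] Ap[of j] \<open>T \<in> _\<close> by (simp del: index_mult_mat(1))
    ultimately show ?case
      using Suc[of "Suc i"] E_entry[of "T ^\<^sub>m i" "A ^\<^sub>m j"] by (simp add: b_def[of i] del: index_mult_mat(1) pow_mat.simps)
  qed
  \<comment> \<open>The \<open>A\<close> next to the run of \<open>T\<close> is split: its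
    \<open>E\<close> part is a walk moment by cyclicity of the trace, and its \<open>T\<close> part
    joins the run.\<close>
  have tele: "mat_trace (A ^\<^sub>m j * T ^\<^sub>m i)
      = (\<Sum>k<j. walk_moment b k (i + j - 1 - k)) + mat_trace (T ^\<^sub>m (i + j))" for i j
  proof (induction j arbitrary: i)
    case 0
    then show ?case using left_mult_one_mat[OF Tp[of i]] \<open>A \<in> _\<close> by simp
  next
    case (Suc j)
    have "A ^\<^sub>m Suc j * T ^\<^sub>m i = A ^\<^sub>m j * E * T ^\<^sub>m i + A ^\<^sub>m j * T * T ^\<^sub>m i"
      using split[of "A ^\<^sub>m j" "T ^\<^sub>m i"] by simp
    also have "A ^\<^sub>m j * T * T ^\<^sub>m i = A ^\<^sub>m j * T ^\<^sub>m Suc i"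
      unfolding pow_mat_Suc_left[OF \<open>T \<in> _\<close>] by (rule assoc_mult_mat[of _ n n _ n _ n]) auto
    finally have "mat_trace (A ^\<^sub>m Suc j * T ^\<^sub>m i)
        = mat_trace (A ^\<^sub>m j * E * T ^\<^sub>m i) + mat_trace (A ^\<^sub>m j * T ^\<^sub>m Suc i)"
      by (simp only: mat_trace_add[OF mult_carrier_mat[OF mult_carrier_mat[OF Ap \<open>E \<in> _\<close>] Tp]
          mult_carrier_mat[OF Ap Tp]])
    also have "mat_trace (A ^\<^sub>m j * E * T ^\<^sub>m i) = walk_moment b j i"
      using E_trace[of "A ^\<^sub>m j" "T ^\<^sub>m i"] walk by simp
    finally show ?case unfolding Suc[of "Suc i"] by (simp del: pow_mat.simps)
  qed
  have "T\<^sup>T = - T"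
  proof (rule eq_matI)
    fix i j assume "i < dim_row (- T)" "j < dim_col (- T)"
    then show "T\<^sup>T $$ (i, j) = (- T) $$ (i, j)"
      using skew[of j i] by (simp add: T_def)
  qed auto
  then have "mat_trace (T ^\<^sub>m l) = 0" using mat_trace_skew_odd_pow[of T n l] l by simp
  then have "mat_trace (A ^\<^sub>m l) = cycle_moment b l"
    using tele[of l 0] right_mult_one_mat[OF Ap[of l]] \<open>T \<in> _\<close> by (simp add: cycle_moment_def)
  then show ?thesis unfolding A_def b_def T_def .
qed

section \<open>Location of the eigenvalues\<close>

text \<open>For skew \<open>t\<close> the left side is the square of twice the bilinear form of
  \<open>t\<close>. Cauchy-Schwarz is applied against the antisymmetric array x_i y_j - x_j y_i,
  whose squared norm is 2 (|x|^2 |y|^2 - <x, y>^2) by Lagrange's identity. This halves the plain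
  bound 4 |x|^2 |y|^2 and is the source of the 1/2 in the eigenvalue estimate.\<close>

lemma skew_form_bound:
  fixes t :: "nat \<Rightarrow> nat \<Rightarrow> real"
  assumes "(\<Sum>i<n. \<Sum>j<n. (t i j)\<^sup>2) \<le> 1"
  shows "(\<Sum>i<n. \<Sum>j<n. t i j * (x i * y j - x j * y i))\<^sup>2
      \<le> 2 * (\<Sum>i<n. (x i)\<^sup>2) * (\<Sum>i<n. (y i)\<^sup>2)"
proof -
  define S where "S = {..<n} \<times> {..<n}"
  define p where "p = (\<lambda>(i, j). x i * y j - x j * y i)"
  have "(\<Sum>i<n. \<Sum>j<n. t i j * (x i * y j - x j * y i))\<^sup>2 = (\<Sum>(i, j)\<in>S. t i j * p (i, j))\<^sup>2"
    by (simp add: S_def p_def sum.cartesian_product)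
  also have "\<dots> \<le> (\<Sum>(i, j)\<in>S. (t i j)\<^sup>2) * (\<Sum>q\<in>S. (p q)\<^sup>2)"
    using Cauchy_Schwarz_ineq_sum[of "\<lambda>(i, j). t i j" p S] by (simp add: case_prod_beta)
  also have "\<dots> \<le> 1 * (\<Sum>q\<in>S. (p q)\<^sup>2)"
    using assms by (intro mult_right_mono sum_nonneg) (auto simp: S_def sum.cartesian_product)
  also have "(\<Sum>q\<in>S. (p q)\<^sup>2) = (\<Sum>i<n. \<Sum>j<n. (x i * y j - x j * y i)\<^sup>2)"
    by (simp add: S_def p_def sum.cartesian_product case_prod_beta)
  also have "\<dots> = (\<Sum>i<n. \<Sum>j<n. (x i)\<^sup>2 * (y j)\<^sup>2) + (\<Sum>i<n. \<Sum>j<n. (x j)\<^sup>2 * (y i)\<^sup>2)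
      - 2 * (\<Sum>i<n. \<Sum>j<n. (x i * y i) * (x j * y j))"
    unfolding sum_distrib_left sum.distrib[symmetric] sum_subtractf[symmetric]
    by (intro sum.cong refl) (simp add: power2_eq_square algebra_simps)
  also have "(\<Sum>i<n. \<Sum>j<n. (x j)\<^sup>2 * (y i)\<^sup>2) = (\<Sum>i<n. \<Sum>j<n. (x i)\<^sup>2 * (y j)\<^sup>2)"
    by (rule sum.swap)
  also have "(\<Sum>i<n. \<Sum>j<n. (x i)\<^sup>2 * (y j)\<^sup>2) = (\<Sum>i<n. (x i)\<^sup>2) * (\<Sum>i<n. (y i)\<^sup>2)"
    by (rule sum_product[symmetric])
  also have "(\<Sum>i<n. \<Sum>j<n. (x i * y i) * (x j * y j)) = (\<Sum>i<n. x i * y i)\<^sup>2"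
    unfolding power2_eq_square by (rule sum_product[symmetric])
  finally show ?thesis
    using zero_le_power2[of "\<Sum>i<n. x i * y i"] unfolding mult.assoc mult_1 by linarith
qed

lemma skew_quadratic_form:
  fixes w :: "nat \<Rightarrow> real"
  assumes skew: "\<And>i j. i < n \<Longrightarrow> j < n \<Longrightarrow> t i j = - t j i"
  shows "(\<Sum>i<n. \<Sum>j<n. t i j * (w i * w j)) = 0"
proof -
  have "(\<Sum>i<n. \<Sum>j<n. t i j * (w i * w j)) = (\<Sum>i<n. \<Sum>j<n. t j i * (w j * w i))"
    by (rule sum.swap)
  also have "\<dots> = - (\<Sum>i<n. \<Sum>j<n. t i j * (w i * w j))"
    unfolding sum_negf[symmetric]
    by (intro sum.cong refl) (metis skew lessThan_iff mult.commute mult_minus_left)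
  finally show ?thesis by simp
qed

lemma bordered_quadratic_form:
  fixes x :: "nat \<Rightarrow> real"
  assumes n: "n > 0" and skew: "\<And>i j. i < n \<Longrightarrow> j < n \<Longrightarrow> t i j = - t j i"
  shows "(\<Sum>i<n. \<Sum>j<n. bordered n t $$ (i, j) * (x i * x j)) = (x 0)\<^sup>2"
proof -
  have z: "(\<Sum>i<n. \<Sum>j<n. t i j * (x i * x j)) = 0" by (rule skew_quadratic_form) (rule skew)
  have "(\<Sum>i<n. \<Sum>j<n. bordered n t $$ (i, j) * (x i * x j))
      = (\<Sum>i<n. \<Sum>j<n. t i j * (x i * x j)) + (\<Sum>i<n. \<Sum>j<n. if j = 0 then if i = 0 then (x 0)\<^sup>2 else 0 else 0)"
    unfolding sum.distrib[symmetric]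
    by (intro sum.cong refl) (auto simp: bordered_def power2_eq_square algebra_simps)
  then show ?thesis using z n by simp
qed

lemma bordered_skew_form:
  fixes x y :: "nat \<Rightarrow> real"
  shows "(\<Sum>i<n. \<Sum>j<n. bordered n t $$ (i, j) * (x i * y j - y i * x j))
      = (\<Sum>i<n. \<Sum>j<n. t i j * (x i * y j - x j * y i))"
  by (intro sum.cong refl) (auto simp: bordered_def algebra_simps)

text \<open>The symmetric part of the bordered matrix is the projection onto the first basis vector, so
  pairing an eigenvector with itself locates the eigenvalue.\<close>

lemma bordered_eigenvalue:
  fixes t :: "nat \<Rightarrow> nat \<Rightarrow> real"
  assumes n: "n > 0" and skew: "\<And>i j. i < n \<Longrightarrow> j < n \<Longrightarrow> t i j = - t j i"
    and hs: "(\<Sum>i<n. \<Sum>j<n. (t i j)\<^sup>2) \<le> 1"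
    and ev: "eigenvalue (map_mat complex_of_real (bordered n t)) z"
  shows "Re z \<ge> 0" and "(Im z)\<^sup>2 \<le> 1 / 2" and "eigenvalue (map_mat complex_of_real (bordered n t)) (cnj z)"
    and "z = 1 \<Longrightarrow> i < n \<Longrightarrow> t i 0 = 0"
proof -
  let ?A = "bordered n t"
  let ?C = "map_mat complex_of_real ?A"
  have C: "?C \<in> carrier_mat n n" by simp
  from ev obtain v where v: "v \<in> carrier_vec n" "v \<noteq> 0\<^sub>v n" "?C *\<^sub>v v = z \<cdot>\<^sub>v v"
    unfolding eigenvalue_def eigenvector_def by (auto simp: bordered_def)
  define x where "x i = Re (v $ i)" for i
  define y where "y i = Im (v $ i)" for i
  have row: "(\<Sum>j<n. complex_of_real (?A $$ (i, j)) * v $ j) = z * v $ i" if "i < n" for i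
  proof -
    have "(?C *\<^sub>v v) $ i = (z \<cdot>\<^sub>v v) $ i" using v by simp
    then show ?thesis using that v(1)
      by (simp add: scalar_prod_def lessThan_atLeast0 bordered_def)
  qed
  have rx: "(\<Sum>j<n. ?A $$ (i, j) * x j) = Re z * x i - Im z * y i"
    and ry: "(\<Sum>j<n. ?A $$ (i, j) * y j) = Re z * y i + Im z * x i" if "i < n" for i
    using row[OF that] by (auto simp: complex_eq_iff x_def y_def)
  define N where "N = (\<Sum>i<n. (x i)\<^sup>2) + (\<Sum>i<n. (y i)\<^sup>2)"
  have "N > 0"
  proof -
    from v(1,2) obtain k where k: "k < n" "v $ k \<noteq> 0" by (metis carrier_vecD eq_vecI index_zero_vec)
    have "(x k)\<^sup>2 + (y k)\<^sup>2 > 0" using k by (simp add: x_def y_def complex_eq_iff sum_power2_gt_zero_iff)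
    also have "(x k)\<^sup>2 + (y k)\<^sup>2 \<le> N"
      unfolding N_def by (intro add_mono member_le_sum) (use k in auto)
    finally show ?thesis .
  qed
  \<comment> \<open>The real part of the Hermitian form of the matrix at \<open>v\<close>, to which
    the skew part contributes nothing.\<close>
  have "Re z * N = (\<Sum>i<n. x i * (Re z * x i - Im z * y i)) + (\<Sum>i<n. y i * (Re z * y i + Im z * x i))"
    unfolding N_def distrib_left sum_distrib_left sum.distrib[symmetric]
    by (intro sum.cong refl) (simp add: power2_eq_square algebra_simps)
  also have "\<dots> = (\<Sum>i<n. x i * (\<Sum>j<n. ?A $$ (i, j) * x j)) + (\<Sum>i<n. y i * (\<Sum>j<n. ?A $$ (i, j) * y j))"
    by (simp add: rx ry)
  also have "\<dots> = (\<Sum>i<n. \<Sum>j<n. ?A $$ (i, j) * (x i * x j)) + (\<Sum>i<n. \<Sum>j<n. ?A $$ (i, j) * (y i * y j))"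
    by (simp add: sum_distrib_left mult_ac)
  also have "\<dots> = (x 0)\<^sup>2 + (y 0)\<^sup>2"
    by (intro arg_cong2[where f = "(+)"] bordered_quadratic_form[OF n] skew)
  finally have re: "Re z * N = (x 0)\<^sup>2 + (y 0)\<^sup>2" .
  then show "Re z \<ge> 0" using \<open>N > 0\<close> by (metis sum_power2_ge_zero zero_le_mult_iff not_less)
  \<comment> \<open>The imaginary part of the same form; here the symmetric border cancels.\<close>
  have "Im z * N = (\<Sum>i<n. x i * (Re z * y i + Im z * x i)) - (\<Sum>i<n. y i * (Re z * x i - Im z * y i))"
    unfolding N_def distrib_left sum_distrib_left sum.distrib[symmetric] sum_subtractf[symmetric]
    by (intro sum.cong refl) (simp add: power2_eq_square algebra_simps)
  also have "\<dots> = (\<Sum>i<n. x i * (\<Sum>j<n. ?A $$ (i, j) * y j)) - (\<Sum>i<n. y i * (\<Sum>j<n. ?A $$ (i, j) * x j))"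
    by (simp add: rx ry)
  also have "\<dots> = (\<Sum>i<n. \<Sum>j<n. ?A $$ (i, j) * (x i * y j - y i * x j))"
    by (simp add: sum_distrib_left sum_subtractf[symmetric] algebra_simps)
  finally have im: "Im z * N = (\<Sum>i<n. \<Sum>j<n. t i j * (x i * y j - x j * y i))"
    unfolding bordered_skew_form .
  have "(Im z * N)\<^sup>2 \<le> 2 * (\<Sum>i<n. (x i)\<^sup>2) * (\<Sum>i<n. (y i)\<^sup>2)"
    unfolding im by (rule skew_form_bound[OF hs])
  \<comment> \<open>The product of the two summands of \<open>N\<close> is at most N^2 / 4.\<close>
  also have "\<dots> \<le> N\<^sup>2 / 2"
    unfolding N_def using zero_le_power2[of "(\<Sum>i<n. (x i)\<^sup>2) - (\<Sum>i<n. (y i)\<^sup>2)"]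
    by (simp add: power2_eq_square algebra_simps)
  finally have "(Im z)\<^sup>2 * N\<^sup>2 \<le> 1 / 2 * N\<^sup>2" by (simp add: power_mult_distrib)
  then show "(Im z)\<^sup>2 \<le> 1 / 2" using \<open>N > 0\<close> by (simp only: mult_le_cancel_right) auto
  show "eigenvalue ?C (cnj z)"
    unfolding eigenvalue_def eigenvector_def
  proof (intro exI[of _ "map_vec cnj v"] conjI)
    show "map_vec cnj v \<in> carrier_vec (dim_row ?C)" using v by (auto simp: bordered_def)
    show "map_vec cnj v \<noteq> 0\<^sub>v (dim_row ?C)"
    proof
      assume "map_vec cnj v = 0\<^sub>v (dim_row ?C)"
      then have "v $ i = 0" if "i < n" for i
        using that v(1) C by (metis carrier_matD(1) carrier_vecD complex_cnj_zero_iff index_map_vec(1) index_zero_vec(1))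
      then have "v = 0\<^sub>v n" using v(1) by (intro eq_vecI) auto
      with v(2) show False by simp
    qed
    show "?C *\<^sub>v map_vec cnj v = cnj z \<cdot>\<^sub>v map_vec cnj v"
    proof (rule eq_vecI)
      fix i assume "i < dim_vec (cnj z \<cdot>\<^sub>v map_vec cnj v)"
      then have i: "i < n" using v by simp
      have "(?C *\<^sub>v map_vec cnj v) $ i = (\<Sum>j<n. complex_of_real (?A $$ (i, j)) * cnj (v $ j))"
        using i v(1) by (simp add: scalar_prod_def lessThan_atLeast0 bordered_def)
      also have "\<dots> = cnj (\<Sum>j<n. complex_of_real (?A $$ (i, j)) * v $ j)" by simp
      finally show "(?C *\<^sub>v map_vec cnj v) $ i = (cnj z \<cdot>\<^sub>v map_vec cnj v) $ i"
        unfolding row[OF i] using i v(1) by simp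
    qed (use v C in \<open>auto simp: bordered_def\<close>)
  qed
  assume z: "z = 1" and i: "i < n"
  \<comment> \<open>For z = 1 the identity \<open>re\<close> says that coordinate 0 carries the
    whole norm of \<open>v\<close>. Row i of the eigenvector equation then reduces to t i 0 times
    that coordinate.\<close>
  have off: "x k = 0 \<and> y k = 0" if k: "k < n" "k \<noteq> 0" for k
  proof -
    have "(x 0)\<^sup>2 + (x k)\<^sup>2 = (\<Sum>i\<in>{0, k}. (x i)\<^sup>2)" "(y 0)\<^sup>2 + (y k)\<^sup>2 = (\<Sum>i\<in>{0, k}. (y i)\<^sup>2)"
      using k by auto
    moreover have "(\<Sum>i\<in>{0, k}. (x i)\<^sup>2) \<le> (\<Sum>i<n. (x i)\<^sup>2)" "(\<Sum>i\<in>{0, k}. (y i)\<^sup>2) \<le> (\<Sum>i<n. (y i)\<^sup>2)"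
      by (intro sum_mono2; use k n in auto)+
    ultimately have "(x k)\<^sup>2 + (y k)\<^sup>2 \<le> 0" using re z unfolding N_def by simp
    then show ?thesis by (simp add: sum_power2_le_zero_iff)
  qed
  show "t i 0 = 0"
  proof (cases "i = 0")
    case True
    then show ?thesis using skew[of 0 0] n by simp
  next
    case False
    have single: "(\<Sum>j<n. ?A $$ (i, j) * w j) = t i 0 * w 0" if "\<And>k. k < n \<Longrightarrow> k \<noteq> 0 \<Longrightarrow> w k = 0" for w
    proof -
      have "(\<Sum>j<n. ?A $$ (i, j) * w j) = (\<Sum>j\<in>{0}. ?A $$ (i, j) * w j)"
        using n that by (intro sum.mono_neutral_right) auto
      then show ?thesis using i n False by (simp add: bordered_def)
    qed
    have "t i 0 * x 0 = 0" "t i 0 * y 0 = 0"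
      using rx[OF i] ry[OF i] single[of x] single[of y] off off[OF i False] z by auto
    moreover have "x 0 \<noteq> 0 \<or> y 0 \<noteq> 0" using re \<open>N > 0\<close> z by auto
    ultimately show ?thesis by auto
  qed
qed

text \<open>For a nonreal eigenvalue and its conjugate: together they contribute twice their common
  real part to a sum equal to 1, which caps it at 1/2.\<close>

lemma two_terms_le_sum_list:
  fixes f :: "'a \<Rightarrow> real"
  assumes "a \<in> set xs" "b \<in> set xs" "a \<noteq> b" "\<And>x. x \<in> set xs \<Longrightarrow> f x \<ge> 0"
  shows "f a + f b \<le> (\<Sum>x\<leftarrow>xs. f x)"
proof -
  have b: "b \<in> set (remove1 a xs)" using assms by (simp add: in_set_remove1)
  have "(\<Sum>x\<leftarrow>xs. f x) = f a + (f b + (\<Sum>x\<leftarrow>remove1 b (remove1 a xs). f x))"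
    by (simp add: sum_list_map_remove1[OF assms(1)] sum_list_map_remove1[OF b])
  moreover have "(\<Sum>x\<leftarrow>remove1 b (remove1 a xs). f x) \<ge> 0"
    using assms(4) by (intro sum_list_nonneg) (auto dest!: notin_set_remove1 set_remove1_subset[THEN subsetD])
  ultimately show ?thesis by simp
qed

theorem bordered_trace_bound:
  fixes t :: "nat \<Rightarrow> nat \<Rightarrow> real"
  assumes n: "n > 0" and skew: "\<And>i j. i < n \<Longrightarrow> j < n \<Longrightarrow> t i j = - t j i"
    and hs: "(\<Sum>i<n. \<Sum>j<n. (t i j)\<^sup>2) \<le> 1" and l: "odd l" "l \<ge> 3" "l \<noteq> 5"
  shows "mat_trace (bordered n t ^\<^sub>m l) \<le> 1"
    and "mat_trace (bordered n t ^\<^sub>m l) = 1 \<Longrightarrow> i < n \<Longrightarrow> t i 0 = 0"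
proof -
  let ?A = "bordered n t"
  let ?C = "map_mat complex_of_real ?A"
  have C: "?C \<in> carrier_mat n n" by simp
  from char_poly_factorized[OF C] obtain es where es: "char_poly ?C = (\<Prod>a\<leftarrow>es. [:- a, 1:])" by auto
  have ev_iff: "eigenvalue ?C z \<longleftrightarrow> z \<in> set es" for z
    unfolding eigenvalue_root_char_poly[OF C] es poly_prod_list prod_list_zero_iff by force
  have ev: "Re z \<ge> 0" "(Im z)\<^sup>2 \<le> 1 / 2" "cnj z \<in> set es" if "z \<in> set es" for z
    using bordered_eigenvalue(1-3)[OF n skew hs, of z] that ev_iff by blast+
  have tr: "mat_trace (?A ^\<^sub>m k) = (\<Sum>e\<leftarrow>es. Re (e ^ k))" for k
  proof -
    have "complex_of_real (mat_trace (?A ^\<^sub>m k)) = mat_trace (map_mat complex_of_real (?A ^\<^sub>m k))"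
      unfolding mat_trace_def of_real_sum
      using carrier_matD[OF pow_carrier_mat[OF bordered_carrier[of n t], of k]] by (intro sum.cong) auto
    also have "\<dots> = (\<Sum>e\<leftarrow>es. e ^ k)"
      using mat_trace_pow_eigenvalues[OF C es] of_real_hom.mat_hom_pow[OF bordered_carrier] by metis
    finally have "mat_trace (?A ^\<^sub>m k) = Re (\<Sum>e\<leftarrow>es. e ^ k)" by (metis Re_complex_of_real)
    also have "\<dots> = (\<Sum>e\<leftarrow>es. Re (e ^ k))" by (induction es) auto
    finally show ?thesis .
  qed
  have "mat_trace (?A ^\<^sub>m 1) = 1"
  proof -
    have "t i i = 0" if "i < n" for i using skew[OF that that] by simp
    then have "(\<Sum>i<n. ?A $$ (i, i)) = (\<Sum>i<n. if i = 0 then 1 else 0)"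
      by (intro sum.cong refl) (auto simp: bordered_def)
    then show ?thesis using n by (simp add: mat_trace_def bordered_def)
  qed
  then have sum1: "(\<Sum>e\<leftarrow>es. Re e) = 1" using tr[of 1] by simp
  have le1: "Re z \<le> 1" if "z \<in> set es" for z
    using member_le_sum_list[of "Re z" "map Re es"] that ev sum1 by force
  have half: "Re z \<le> 1 / 2" if "z \<in> set es" "Im z \<noteq> 0" for z
    using two_terms_le_sum_list[of z es "cnj z" Re] that ev sum1 by (auto simp: complex_eq_iff)
  have le: "Re (z ^ l) \<le> Re z" and eq: "Re (z ^ l) = Re z \<Longrightarrow> Re z > 0 \<Longrightarrow> z = 1" if "z \<in> set es" for z
    using Re_odd_power_le_Re[OF l, of z] ev[OF that] le1[OF that] half[OF that] by auto
  show "mat_trace (?A ^\<^sub>m l) \<le> 1"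
    unfolding tr sum1[symmetric] by (rule sum_list_mono) (rule le)
  assume "mat_trace (?A ^\<^sub>m l) = 1" and i: "i < n"
  then have "(\<Sum>e\<leftarrow>es. Re e - Re (e ^ l)) = 0"
    by (simp add: tr sum1 sum_list_subtractf)
  moreover have "0 \<le> x" if "x \<in> set (map (\<lambda>e. Re e - Re (e ^ l)) es)" for x
    using that le by auto
  ultimately have all_eq: "\<forall>z\<in>set es. Re (z ^ l) = Re z"
    using sum_list_nonneg_eq_0_iff[of "map (\<lambda>e. Re e - Re (e ^ l)) es"] by auto
  \<comment> \<open>The real parts sum to 1, so some eigenvalue has positive real part, and the
    equality case makes it 1.\<close>
  have "\<exists>z\<in>set es. Re z \<noteq> 0"
  proof (rule ccontr)
    assume "\<not> ?thesis"
    then have "map Re es = map (\<lambda>_. 0) es" by auto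
    then show False using sum1 by (metis sum_list_0 zero_neq_one)
  qed
  then obtain z where z: "z \<in> set es" "Re z \<noteq> 0" by blast
  then have "z = 1" using eq all_eq ev by (metis less_eq_real_def)
  then show "t i 0 = 0" using bordered_eigenvalue(4)[OF n skew hs, of z i] ev_iff z i by simp
qed

text \<open>With X = |T e_0|^2 and Y = |T^2 e_0|^2 the moment is 1 - 5 X + 5 Y, and skewness bounds
  the squared operator norm of T by 1/2, so that 2 Y <= X.\<close>

lemma skew_cycle_moment_five:
  fixes t :: "nat \<Rightarrow> nat \<Rightarrow> real"
  assumes n: "n > 0" and skew: "\<And>i j. i < n \<Longrightarrow> j < n \<Longrightarrow> t i j = - t j i"
    and hs: "(\<Sum>i<n. \<Sum>j<n. (t i j)\<^sup>2) \<le> 1"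
  shows "cycle_moment (\<lambda>k. (mat n n (\<lambda>(i, j). t i j) ^\<^sub>m k) $$ (0, 0)) 5 \<le> 1 - 5 / 2 * (\<Sum>i<n. (t i 0)\<^sup>2)"
proof -
  define T where "T = mat n n (\<lambda>(i, j). t i j)"
  have T: "T \<in> carrier_mat n n" by (simp add: T_def)
  have T_nth: "T $$ (i, j) = t i j" if "i < n" "j < n" for i j using that by (simp add: T_def)
  define c where "c i = (\<Sum>j<n. t i j * t j 0)" for i
  define X where "X = (\<Sum>i<n. (t i 0)\<^sup>2)"
  define Y where "Y = (\<Sum>i<n. (c i)\<^sup>2)"
  have T2: "T * T \<in> carrier_mat n n" using T by simp
  have T2_col: "(T * T) $$ (i, 0) = c i" and T2_row: "(T * T) $$ (0, i) = c i" if "i < n" for i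
  proof -
    show "(T * T) $$ (i, 0) = c i"
      unfolding index_mult_mat_sum[OF T T that n] c_def using that n by (simp add: T_nth)
    show "(T * T) $$ (0, i) = c i"
      unfolding index_mult_mat_sum[OF T T n that] c_def
    proof (rule sum.cong[OF refl])
      fix j assume "j \<in> {..<n}"
      then show "T $$ (0, j) * T $$ (j, i) = t i j * t j 0"
        using that n skew[of 0 j] skew[of j i] by (simp add: T_nth)
    qed
  qed
  have skew_zero: "(\<Sum>i<n. \<Sum>j<n. t i j * (w i * w j)) = 0" for w
    by (rule skew_quadratic_form) (rule skew)
  have row0: "t 0 k = - t k 0" if "k < n" for k using skew[of 0 k] n that by simp
  have b2: "(T * T) $$ (0, 0) = - X"
    unfolding T2_col[OF n] c_def X_def sum_negf[symmetric]
    by (intro sum.cong refl) (simp add: row0 power2_eq_square)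
  have b3: "(T * (T * T)) $$ (0, 0) = 0"
  proof -
    have "(T * (T * T)) $$ (0, 0) = (\<Sum>k<n. T $$ (0, k) * (T * T) $$ (k, 0))"
      by (rule index_mult_mat_sum[OF T T2 n n])
    also have "\<dots> = (\<Sum>k<n. - (\<Sum>j<n. t k j * (t k 0 * t j 0)))"
    proof (rule sum.cong[OF refl])
      fix k assume "k \<in> {..<n}"
      then have k: "k < n" by simp
      show "T $$ (0, k) * (T * T) $$ (k, 0) = - (\<Sum>j<n. t k j * (t k 0 * t j 0))"
        unfolding T2_col[OF k] T_nth[OF n k] row0[OF k] c_def
        by (simp add: sum_distrib_left sum_negf mult_ac)
    qed
    also have "\<dots> = 0" using skew_zero[of "\<lambda>k. t k 0"] by (simp add: sum_negf)
    finally show ?thesis .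
  qed
  have b4: "(T * T * (T * T)) $$ (0, 0) = Y"
    unfolding index_mult_mat_sum[OF T2 T2 n n] Y_def power2_eq_square
    by (intro sum.cong refl) (simp add: T2_col T2_row del: index_mult_mat(1))
  have pow: "T ^\<^sub>m 2 = T * T" "T ^\<^sub>m 3 = T * (T * T)" "T ^\<^sub>m 4 = T * T * (T * T)"
    using assoc_mult_mat[OF T T T] assoc_mult_mat[OF T2 T T] T by (simp_all add: eval_nat_numeral)
  have "cycle_moment (\<lambda>k. (T ^\<^sub>m k) $$ (0, 0)) 5 = 1 + 5 * (T ^\<^sub>m 2) $$ (0, 0) + 5 * (T ^\<^sub>m 4) $$ (0, 0)"
  proof (rule cycle_moment_five)
    show "(T ^\<^sub>m 0) $$ (0, 0) = 1" using T n by simp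
    show "(T ^\<^sub>m 1) $$ (0, 0) = 0" using T T_nth[OF n n] row0[OF n] by simp
    show "(T ^\<^sub>m 3) $$ (0, 0) = 0" unfolding pow by (rule b3)
  qed
  then have cm: "cycle_moment (\<lambda>k. (T ^\<^sub>m k) $$ (0, 0)) 5 = 1 - 5 * X + 5 * Y"
    unfolding pow b2 b4 by simp
  \<comment> \<open>\<open>skew_form_bound\<close> is applied to T^2 e_0 and T e_0, whose form value
    is again Y; cancelling one factor Y leaves 2 Y <= X.\<close>
  have "(2 * Y)\<^sup>2 \<le> 2 * Y * X"
  proof -
    have "(\<Sum>i<n. \<Sum>j<n. t i j * (c i * t j 0 - c j * t i 0))
        = (\<Sum>i<n. \<Sum>j<n. t i j * (c i * t j 0)) - (\<Sum>i<n. \<Sum>j<n. t i j * (c j * t i 0))"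
      by (simp add: sum_subtractf right_diff_distrib)
    also have "(\<Sum>i<n. \<Sum>j<n. t i j * (c j * t i 0)) = (\<Sum>i<n. \<Sum>j<n. t j i * (c i * t j 0))"
      by (rule sum.swap)
    also have "\<dots> = - (\<Sum>i<n. \<Sum>j<n. t i j * (c i * t j 0))"
      unfolding sum_negf[symmetric]
      by (intro sum.cong refl) (metis skew lessThan_iff mult_minus_left)
    also have "(\<Sum>i<n. \<Sum>j<n. t i j * (c i * t j 0)) = Y"
      unfolding Y_def power2_eq_square by (subst (3) c_def) (simp add: sum_distrib_left mult_ac)
    finally have "(\<Sum>i<n. \<Sum>j<n. t i j * (c i * t j 0 - c j * t i 0)) = 2 * Y" by simp
    then show ?thesis
      using skew_form_bound[OF hs, of c "\<lambda>j. t j 0"] by (simp add: X_def Y_def)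
  qed
  moreover have "Y \<ge> 0" unfolding Y_def by (intro sum_nonneg) simp
  moreover have "X \<ge> 0" unfolding X_def by (intro sum_nonneg) simp
  ultimately have "2 * Y \<le> X"
    by (cases "Y = 0") (auto simp: power2_eq_square)
  then show ?thesis using cm unfolding T_def X_def by simp
qed

lemma skew_cycle_moment_bound:
  fixes t :: "nat \<Rightarrow> nat \<Rightarrow> real"
  assumes n: "n > 0" and skew: "\<And>i j. i < n \<Longrightarrow> j < n \<Longrightarrow> t i j = - t j i"
    and hs: "(\<Sum>i<n. \<Sum>j<n. (t i j)\<^sup>2) \<le> 1" and l: "odd l" "l \<ge> 3"
  defines "b \<equiv> \<lambda>k. (mat n n (\<lambda>(i, j). t i j) ^\<^sub>m k) $$ (0, 0)"
  shows "cycle_moment b l \<le> 1" and "cycle_moment b l = 1 \<Longrightarrow> i < n \<Longrightarrow> t i 0 = 0"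
proof -
  have five: "l = 5 \<Longrightarrow> cycle_moment b l \<le> 1 - 5 / 2 * (\<Sum>i<n. (t i 0)\<^sup>2)"
    unfolding b_def using skew_cycle_moment_five[OF n skew hs] by blast
  have other: "cycle_moment b l = mat_trace (bordered n t ^\<^sub>m l)"
    unfolding b_def using mat_trace_bordered_pow[OF n skew l(1)] by simp
  have nn: "(\<Sum>i<n. (t i 0)\<^sup>2) \<ge> 0" by (intro sum_nonneg) simp
  show "cycle_moment b l \<le> 1"
  proof (cases "l = 5")
    case True
    then show ?thesis using five nn by linarith
  next
    case False
    then show ?thesis unfolding other using bordered_trace_bound(1)[OF n skew hs l] by blast
  qed
  assume eq: "cycle_moment b l = 1" and i: "i < n"
  show "t i 0 = 0"
  proof (cases "l = 5")
    case True
    then have "(\<Sum>i<n. (t i 0)\<^sup>2) = 0" using five eq nn by linarith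
    then show ?thesis using i by (simp add: sum_nonneg_eq_0_iff)
  next
    case False
    then show ?thesis using eq i unfolding other using bordered_trace_bound(2)[OF n skew hs l] by blast
  qed
qed

section \<open>Integral kernels\<close>

context prob_space
begin

definition bounded_fun :: "('a \<Rightarrow> real) \<Rightarrow> bool" where
  "bounded_fun f \<longleftrightarrow> f \<in> borel_measurable M \<and> (\<exists>C. \<forall>x\<in>space M. \<bar>f x\<bar> \<le> C)"

text \<open>The bound is imposed everywhere rather than almost everywhere, because
  \<open>kernel_trace\<close> looks at the diagonal, which may be a null set.\<close>

definition bounded_kernel :: "('a \<Rightarrow> 'a \<Rightarrow> real) \<Rightarrow> bool" where
  "bounded_kernel K \<longleftrightarrow> case_prod K \<in> borel_measurable (M \<Otimes>\<^sub>M M) \<and>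
     (\<exists>C. \<forall>x\<in>space M. \<forall>y\<in>space M. \<bar>K x y\<bar> \<le> C)"

definition kernel_app :: "('a \<Rightarrow> 'a \<Rightarrow> real) \<Rightarrow> ('a \<Rightarrow> real) \<Rightarrow> 'a \<Rightarrow> real" where
  "kernel_app K f x = (\<integral>y. K x y * f y \<partial>M)"

definition kernel_comp :: "('a \<Rightarrow> 'a \<Rightarrow> real) \<Rightarrow> ('a \<Rightarrow> 'a \<Rightarrow> real) \<Rightarrow> 'a \<Rightarrow> 'a \<Rightarrow> real" where
  "kernel_comp K L x y = (\<integral>z. K x z * L z y \<partial>M)"

definition kernel_trace :: "('a \<Rightarrow> 'a \<Rightarrow> real) \<Rightarrow> real" where
  "kernel_trace K = (\<integral>x. K x x \<partial>M)"

text \<open>There is no identity kernel, so the value on the empty list is junk.\<close>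

fun kernel_prod :: "('a \<Rightarrow> 'a \<Rightarrow> real) list \<Rightarrow> 'a \<Rightarrow> 'a \<Rightarrow> real" where
  "kernel_prod [] = (\<lambda>_ _. 0)"
| "kernel_prod [K] = K"
| "kernel_prod (K # L # Ls) = kernel_comp K (kernel_prod (L # Ls))"

lemma bounded_funI:
  "f \<in> borel_measurable M \<Longrightarrow> (\<And>x. x \<in> space M \<Longrightarrow> \<bar>f x\<bar> \<le> C) \<Longrightarrow> bounded_fun f"
  by (auto simp: bounded_fun_def)

lemma bounded_kernelI:
  "case_prod K \<in> borel_measurable (M \<Otimes>\<^sub>M M) \<Longrightarrow>
    (\<And>x y. x \<in> space M \<Longrightarrow> y \<in> space M \<Longrightarrow> \<bar>K x y\<bar> \<le> C) \<Longrightarrow> bounded_kernel K"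
  by (auto simp: bounded_kernel_def)

lemma bounded_fun_measurable [measurable_dest]: "bounded_fun f \<Longrightarrow> f \<in> borel_measurable M"
  by (simp add: bounded_fun_def)

lemma bounded_kernel_measurable: "bounded_kernel K \<Longrightarrow> case_prod K \<in> borel_measurable (M \<Otimes>\<^sub>M M)"
  by (simp add: bounded_kernel_def)

lemma bounded_fun_integrable: "bounded_fun f \<Longrightarrow> integrable M f"
  unfolding bounded_fun_def by (auto intro!: integrable_const_bound AE_I2)

lemma bounded_fun_const: "bounded_fun (\<lambda>_. c)"
  by (rule bounded_funI) auto

lemma bounded_fun_add:
  assumes "bounded_fun f" "bounded_fun g"
  shows "bounded_fun (\<lambda>x. f x + g x)"
proof -
  from assms obtain C D where CD: "\<forall>x\<in>space M. \<bar>f x\<bar> \<le> C" "\<forall>x\<in>space M. \<bar>g x\<bar> \<le> D"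
    by (auto simp: bounded_fun_def)
  show ?thesis
  proof (rule bounded_funI[of _ "C + D"])
    show "(\<lambda>x. f x + g x) \<in> borel_measurable M" using assms by (auto dest: bounded_fun_measurable)
    show "\<bar>f x + g x\<bar> \<le> C + D" if "x \<in> space M" for x
      using CD that abs_triangle_ineq[of "f x" "g x"] by fastforce
  qed
qed

lemma bounded_fun_mult:
  assumes "bounded_fun f" "bounded_fun g"
  shows "bounded_fun (\<lambda>x. f x * g x)"
proof -
  from assms obtain C D where CD: "\<forall>x\<in>space M. \<bar>f x\<bar> \<le> C" "\<forall>x\<in>space M. \<bar>g x\<bar> \<le> D"
    by (auto simp: bounded_fun_def)
  show ?thesis
  proof (rule bounded_funI[of _ "C * D"])
    show "(\<lambda>x. f x * g x) \<in> borel_measurable M" using assms by (auto dest: bounded_fun_measurable)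
    show "\<bar>f x * g x\<bar> \<le> C * D" if "x \<in> space M" for x
      unfolding abs_mult using CD that by (intro mult_mono) (auto intro: order_trans[OF abs_ge_zero])
  qed
qed

lemma bounded_fun_cmult: "bounded_fun f \<Longrightarrow> bounded_fun (\<lambda>x. c * f x)"
  by (rule bounded_fun_mult[OF bounded_fun_const])

lemma bounded_fun_diff: "bounded_fun f \<Longrightarrow> bounded_fun g \<Longrightarrow> bounded_fun (\<lambda>x. f x - g x)"
  using bounded_fun_add[OF _ bounded_fun_cmult[of g "-1"]] by simp

lemma bounded_fun_sum: "(\<And>i. i \<in> I \<Longrightarrow> bounded_fun (f i)) \<Longrightarrow> bounded_fun (\<lambda>x. \<Sum>i\<in>I. f i x)"
  by (induction I rule: infinite_finite_induct) (auto intro: bounded_fun_add bounded_fun_const)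

lemma bounded_kernel_section:
  assumes "bounded_kernel K" "x \<in> space M"
  shows "bounded_fun (K x)" and "bounded_fun (\<lambda>y. K y x)"
proof -
  note [measurable] = bounded_kernel_measurable[OF assms(1)] assms(2)
  have "K x \<in> borel_measurable M" "(\<lambda>y. K y x) \<in> borel_measurable M" by measurable
  then show "bounded_fun (K x)" "bounded_fun (\<lambda>y. K y x)"
    using assms by (auto simp: bounded_fun_def bounded_kernel_def)
qed

lemma bounded_kernel_diag:
  assumes "bounded_kernel K"
  shows "bounded_fun (\<lambda>x. K x x)"
proof -
  note [measurable] = bounded_kernel_measurable[OF assms]
  have "(\<lambda>x. K x x) \<in> borel_measurable M" by measurable
  then show ?thesis using assms by (auto simp: bounded_fun_def bounded_kernel_def)
qed

lemma bounded_kernel_const: "bounded_kernel (\<lambda>_ _. c)"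
  by (rule bounded_kernelI) auto

lemma bounded_kernel_left: "bounded_fun f \<Longrightarrow> bounded_kernel (\<lambda>x y. f x)"
  unfolding bounded_fun_def bounded_kernel_def by auto

lemma bounded_kernel_add:
  assumes K: "bounded_kernel K" and L: "bounded_kernel L"
  shows "bounded_kernel (\<lambda>x y. K x y + L x y)"
proof -
  from K L obtain C D where CD: "\<forall>x\<in>space M. \<forall>y\<in>space M. \<bar>K x y\<bar> \<le> C" "\<forall>x\<in>space M. \<forall>y\<in>space M. \<bar>L x y\<bar> \<le> D"
    by (auto simp: bounded_kernel_def)
  note [measurable] = bounded_kernel_measurable[OF K] bounded_kernel_measurable[OF L]
  show ?thesis
  proof (rule bounded_kernelI[of _ "C + D"])
    show "case_prod (\<lambda>x y. K x y + L x y) \<in> borel_measurable (M \<Otimes>\<^sub>M M)" by measurable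
    show "\<bar>K x y + L x y\<bar> \<le> C + D" if "x \<in> space M" "y \<in> space M" for x y
      using CD that abs_triangle_ineq[of "K x y" "L x y"] by (meson add_mono order_trans)
  qed
qed

lemma bounded_kernel_mult:
  assumes K: "bounded_kernel K" and L: "bounded_kernel L"
  shows "bounded_kernel (\<lambda>x y. K x y * L x y)"
proof -
  from K L obtain C D where CD: "\<forall>x\<in>space M. \<forall>y\<in>space M. \<bar>K x y\<bar> \<le> C" "\<forall>x\<in>space M. \<forall>y\<in>space M. \<bar>L x y\<bar> \<le> D"
    by (auto simp: bounded_kernel_def)
  note [measurable] = bounded_kernel_measurable[OF K] bounded_kernel_measurable[OF L]
  show ?thesis
  proof (rule bounded_kernelI[of _ "C * D"])
    show "case_prod (\<lambda>x y. K x y * L x y) \<in> borel_measurable (M \<Otimes>\<^sub>M M)" by measurable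
    show "\<bar>K x y * L x y\<bar> \<le> C * D" if "x \<in> space M" "y \<in> space M" for x y
      unfolding abs_mult using CD that by (intro mult_mono) (auto intro: order_trans[OF abs_ge_zero])
  qed
qed

lemma bounded_kernel_swap:
  assumes "bounded_kernel K"
  shows "bounded_kernel (\<lambda>x y. K y x)"
proof -
  note [measurable] = bounded_kernel_measurable[OF assms]
  have "case_prod (\<lambda>x y. K y x) \<in> borel_measurable (M \<Otimes>\<^sub>M M)" by measurable
  then show ?thesis using assms by (auto simp: bounded_kernel_def)
qed

lemma abs_integral_le_bound:
  assumes f: "bounded_fun f" and C: "\<And>x. x \<in> space M \<Longrightarrow> \<bar>f x\<bar> \<le> C"
  shows "\<bar>\<integral>x. f x \<partial>M\<bar> \<le> C"
proof -
  have "\<bar>\<integral>x. f x \<partial>M\<bar> \<le> (\<integral>x. \<bar>f x\<bar> \<partial>M)" by (rule integral_abs_bound)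
  also have "\<dots> \<le> (\<integral>x. C \<partial>M)"
    using bounded_fun_integrable[OF f] C by (intro integral_mono) auto
  finally show ?thesis by (simp add: prob_space)
qed

lemma kernel_comp_integrand:
  assumes "bounded_kernel K" "bounded_kernel L" "x \<in> space M" "y \<in> space M"
  shows "bounded_fun (\<lambda>z. K x z * L z y)"
  using assms by (intro bounded_fun_mult bounded_kernel_section)

lemma bounded_kernel_comp:
  assumes K: "bounded_kernel K" and L: "bounded_kernel L"
  shows "bounded_kernel (kernel_comp K L)"
proof -
  from K L obtain C D where CD: "\<forall>x\<in>space M. \<forall>y\<in>space M. \<bar>K x y\<bar> \<le> C" "\<forall>x\<in>space M. \<forall>y\<in>space M. \<bar>L x y\<bar> \<le> D"
    by (auto simp: bounded_kernel_def)
  note [measurable] = bounded_kernel_measurable[OF K] bounded_kernel_measurable[OF L]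
  show ?thesis
  proof (rule bounded_kernelI[of _ "C * D"])
    show "case_prod (kernel_comp K L) \<in> borel_measurable (M \<Otimes>\<^sub>M M)"
      unfolding kernel_comp_def by measurable
    show "\<bar>kernel_comp K L x y\<bar> \<le> C * D" if "x \<in> space M" "y \<in> space M" for x y
      unfolding kernel_comp_def
    proof (rule abs_integral_le_bound)
      show "bounded_fun (\<lambda>z. K x z * L z y)" by (rule kernel_comp_integrand[OF K L that])
      show "\<bar>K x z * L z y\<bar> \<le> C * D" if "z \<in> space M" for z
        unfolding abs_mult using CD that \<open>x \<in> _\<close> \<open>y \<in> _\<close>
        by (intro mult_mono) (auto intro: order_trans[OF abs_ge_zero])
    qed
  qed
qed

lemma kernel_app_integrand:
  "bounded_kernel K \<Longrightarrow> bounded_fun f \<Longrightarrow> x \<in> space M \<Longrightarrow> bounded_fun (\<lambda>y. K x y * f y)"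
  by (rule bounded_fun_mult[OF bounded_kernel_section(1)])

lemma bounded_fun_app:
  assumes K: "bounded_kernel K" and f: "bounded_fun f"
  shows "bounded_fun (kernel_app K f)"
  \<comment> \<open>An application is the diagonal of a composition with a kernel that ignores its
    second argument, so measurability and boundedness are inherited.\<close>
  using bounded_kernel_diag[OF bounded_kernel_comp[OF K bounded_kernel_left[OF f]]]
  by (simp add: kernel_comp_def kernel_app_def[abs_def])

lemma integral_kernel_swap:
  assumes K: "bounded_kernel K"
  shows "(\<integral>x. \<integral>y. K x y \<partial>M \<partial>M) = (\<integral>y. \<integral>x. K x y \<partial>M \<partial>M)"
proof -
  interpret P: pair_prob_space M M ..
  from K obtain C where "\<forall>x\<in>space M. \<forall>y\<in>space M. \<bar>K x y\<bar> \<le> C" by (auto simp: bounded_kernel_def)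
  then have "integrable (M \<Otimes>\<^sub>M M) (case_prod K)"
    using bounded_kernel_measurable[OF K]
    by (intro P.integrable_const_bound[of _ C]) (auto simp: space_pair_measure)
  then show ?thesis using P.Fubini_integral[of K] by simp
qed

lemma kernel_trace_comp_commute:
  assumes "bounded_kernel K" "bounded_kernel L"
  shows "kernel_trace (kernel_comp K L) = kernel_trace (kernel_comp L K)"
  unfolding kernel_trace_def kernel_comp_def
  using integral_kernel_swap[OF bounded_kernel_mult[OF assms(1) bounded_kernel_swap[OF assms(2)]]]
  by (simp add: mult.commute)

lemma kernel_app_cong:
  "(\<And>y. y \<in> space M \<Longrightarrow> f y = g y) \<Longrightarrow> kernel_app K f x = kernel_app K g x"
  unfolding kernel_app_def by (rule Bochner_Integration.integral_cong) auto

lemma kernel_comp_cong: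
  "(\<And>z. z \<in> space M \<Longrightarrow> K x z = K' x z) \<Longrightarrow> (\<And>z. z \<in> space M \<Longrightarrow> L z y = L' z y) \<Longrightarrow>
    kernel_comp K L x y = kernel_comp K' L' x y"
  unfolding kernel_comp_def by (rule Bochner_Integration.integral_cong) auto

lemma kernel_trace_cong:
  "(\<And>x. x \<in> space M \<Longrightarrow> K x x = L x x) \<Longrightarrow> kernel_trace K = kernel_trace L"
  unfolding kernel_trace_def by (rule Bochner_Integration.integral_cong) auto

lemma kernel_app_comp:
  assumes K: "bounded_kernel K" and L: "bounded_kernel L" and f: "bounded_fun f" and x: "x \<in> space M"
  shows "kernel_app (kernel_comp K L) f x = kernel_app K (kernel_app L f) x"
proof -
  have "kernel_app (kernel_comp K L) f x = (\<integral>y. \<integral>z. K x z * L z y * f y \<partial>M \<partial>M)"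
    unfolding kernel_app_def kernel_comp_def
    by (intro Bochner_Integration.integral_cong refl) simp
  also have "\<dots> = (\<integral>z. \<integral>y. K x z * L z y * f y \<partial>M \<partial>M)"
  proof (rule integral_kernel_swap)
    show "bounded_kernel (\<lambda>y z. K x z * L z y * f y)"
      by (intro bounded_kernel_mult bounded_kernel_swap[OF L] bounded_kernel_left[OF f]
          bounded_kernel_swap[OF bounded_kernel_left[OF bounded_kernel_section(1)[OF K x]]])
  qed
  also have "\<dots> = kernel_app K (kernel_app L f) x"
    unfolding kernel_app_def by (simp add: mult.assoc)
  finally show ?thesis .
qed

text \<open>At a fixed second argument, composing with \<open>N\<close> is applying to a section of
  \<open>N\<close>, so this is an instance of \<open>kernel_app_comp\<close>.\<close>

lemma kernel_comp_assoc:
  assumes K: "bounded_kernel K" and L: "bounded_kernel L" and N: "bounded_kernel N"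
    and x: "x \<in> space M" and y: "y \<in> space M"
  shows "kernel_comp (kernel_comp K L) N x y = kernel_comp K (kernel_comp L N) x y"
  using kernel_app_comp[OF K L bounded_kernel_section(2)[OF N y] x]
  by (simp add: kernel_app_def kernel_comp_def)

lemma bounded_kernel_prod:
  "(\<And>K. K \<in> set Ks \<Longrightarrow> bounded_kernel K) \<Longrightarrow> bounded_kernel (kernel_prod Ks)"
  by (induction Ks rule: kernel_prod.induct) (auto intro: bounded_kernel_comp bounded_kernel_const)

lemma kernel_prod_append:
  assumes "Ks \<noteq> []" "Ls \<noteq> []" "\<And>K. K \<in> set Ks \<union> set Ls \<Longrightarrow> bounded_kernel K"
    and x: "x \<in> space M" and y: "y \<in> space M"
  shows "kernel_prod (Ks @ Ls) x y = kernel_comp (kernel_prod Ks) (kernel_prod Ls) x y"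
  using assms
proof (induction Ks arbitrary: x rule: kernel_prod.induct)
  case (2 K)
  then show ?case by (cases Ls) auto
next
  case (3 K L Ks)
  have "kernel_prod ((K # L # Ks) @ Ls) x y = kernel_comp K (kernel_prod ((L # Ks) @ Ls)) x y" by simp
  also have "\<dots> = kernel_comp K (kernel_comp (kernel_prod (L # Ks)) (kernel_prod Ls)) x y"
    by (rule kernel_comp_cong[OF refl]) (rule "3.IH", use "3.prems" in auto)
  also have "\<dots> = kernel_comp (kernel_comp K (kernel_prod (L # Ks))) (kernel_prod Ls) x y"
    by (rule kernel_comp_assoc[symmetric]) (use "3.prems" in \<open>auto intro!: bounded_kernel_prod\<close>)
  finally show ?case by simp
qed simp

lemma kernel_trace_prod_rotate:
  assumes "Ks \<noteq> []" "Ls \<noteq> []" "\<And>K. K \<in> set Ks \<union> set Ls \<Longrightarrow> bounded_kernel K"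
  shows "kernel_trace (kernel_prod (Ks @ Ls)) = kernel_trace (kernel_prod (Ls @ Ks))"
proof -
  have "kernel_trace (kernel_prod (Ks @ Ls)) = kernel_trace (kernel_comp (kernel_prod Ks) (kernel_prod Ls))"
    using assms by (intro kernel_trace_cong kernel_prod_append)
  also have "\<dots> = kernel_trace (kernel_comp (kernel_prod Ls) (kernel_prod Ks))"
    using assms by (intro kernel_trace_comp_commute bounded_kernel_prod) auto
  also have "\<dots> = kernel_trace (kernel_prod (Ls @ Ks))"
    using assms by (intro kernel_trace_cong kernel_prod_append[symmetric]) auto
  finally show ?thesis .
qed

lemma kernel_app_prod:
  assumes "Ks \<noteq> []" "\<And>K. K \<in> set Ks \<Longrightarrow> bounded_kernel K" "bounded_fun f" "x \<in> space M"
  shows "kernel_app (kernel_prod Ks) f x = foldr kernel_app Ks f x"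
  using assms
proof (induction Ks arbitrary: x rule: kernel_prod.induct)
  case (3 K L Ks)
  have "kernel_app (kernel_prod (K # L # Ks)) f x = kernel_app K (kernel_app (kernel_prod (L # Ks)) f) x"
    unfolding kernel_prod.simps
    by (rule kernel_app_comp) (use "3.prems" in \<open>auto intro!: bounded_kernel_prod\<close>)
  also have "\<dots> = kernel_app K (foldr kernel_app (L # Ks) f) x"
    by (rule kernel_app_cong) (rule "3.IH", use "3.prems" in auto)
  finally show ?case by simp
qed auto

end

text \<open>Integrating out the last coordinate merges the two factors that contain it into
  \<open>kernel_comp K L\<close>. The closing kernel \<open>L\<close> is separate from
  \<open>K\<close> and arbitrary so that the induction can absorb this.\<close>

lemma (in prob_space) cube_integral_eq_kernel_trace:
  assumes K: "bounded_kernel K" and L: "bounded_kernel L"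
  shows "(\<integral>x. (\<Prod>i<k. K (x i) (x (Suc i))) * L (x k) (x 0) \<partial>Pi\<^sub>M {..<Suc k} (\<lambda>_. M))
    = kernel_trace (kernel_prod (replicate k K @ [L]))"
  using L
proof (induction k arbitrary: L)
  case 0
  interpret product_sigma_finite "\<lambda>_. M" by unfold_locales
  note [measurable] = bounded_kernel_measurable[OF 0]
  have "(\<integral>x. L (x 0) (x 0) \<partial>Pi\<^sub>M {0} (\<lambda>_. M)) = (\<integral>x. L x x \<partial>M)"
    by (rule product_integral_singleton[of "\<lambda>x. L x x" 0]) measurable
  then show ?case by (simp add: kernel_trace_def lessThan_Suc)
next
  case (Suc k)
  interpret product_sigma_finite "\<lambda>_. M" by unfold_locales
  note mK = bounded_kernel_measurable[OF K] and mL = bounded_kernel_measurable[OF Suc.prems]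
  from K Suc.prems obtain C D where CD: "\<forall>x\<in>space M. \<forall>y\<in>space M. \<bar>K x y\<bar> \<le> C" "\<forall>x\<in>space M. \<forall>y\<in>space M. \<bar>L x y\<bar> \<le> D"
    by (auto simp: bounded_kernel_def)
  let ?f = "\<lambda>x. (\<Prod>i<Suc k. K (x i) (x (Suc i))) * L (x (Suc k)) (x 0)"
  have int: "integrable (Pi\<^sub>M (insert (Suc k) {..<Suc k}) (\<lambda>_. M)) ?f"
  proof -
    interpret P: prob_space "Pi\<^sub>M (insert (Suc k) {..<Suc k}) (\<lambda>_. M)"
      by (rule prob_space_PiM) (rule prob_space_axioms)
    have comp: "(\<lambda>x. x i) \<in> Pi\<^sub>M (insert (Suc k) {..<Suc k}) (\<lambda>_. M) \<rightarrow>\<^sub>M M" if "i \<le> Suc k" for i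
      by (rule measurable_component_singleton) (use that in auto)
    show ?thesis
    proof (rule P.integrable_const_bound[of _ "C ^ Suc k * D"])
      show "?f \<in> borel_measurable (Pi\<^sub>M (insert (Suc k) {..<Suc k}) (\<lambda>_. M))"
        by (intro borel_measurable_times borel_measurable_prod measurable_Pair_compose_split[OF mK]
            measurable_Pair_compose_split[OF mL] comp) auto
      show "AE x in Pi\<^sub>M (insert (Suc k) {..<Suc k}) (\<lambda>_. M). norm (?f x) \<le> C ^ Suc k * D"
      proof (rule AE_I2)
        fix x assume "x \<in> space (Pi\<^sub>M (insert (Suc k) {..<Suc k}) (\<lambda>_. M))"
        then have sp: "x i \<in> space M" if "i \<le> Suc k" for i
          using that by (cases "i = Suc k") (auto simp: space_PiM PiE_def Pi_def)
        have "0 \<le> C" using CD(1) sp[of 0] by (meson abs_ge_zero order_trans le0)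
        have "(\<Prod>i<Suc k. \<bar>K (x i) (x (Suc i))\<bar>) \<le> (\<Prod>i<Suc k. C)"
          by (intro prod_mono) (use CD sp in auto)
        then show "norm (?f x) \<le> C ^ Suc k * D"
          unfolding real_norm_def abs_mult abs_prod using CD sp \<open>0 \<le> C\<close>
          by (intro mult_mono) auto
      qed
    qed
  qed
  have "(\<integral>x. ?f x \<partial>Pi\<^sub>M {..<Suc (Suc k)} (\<lambda>_. M))
      = (\<integral>x. (\<integral>y. ?f (x(Suc k := y)) \<partial>M) \<partial>Pi\<^sub>M {..<Suc k} (\<lambda>_. M))"
    using product_integral_insert[OF _ _ int] by (simp add: lessThan_Suc[of "Suc k"])
  also have "\<dots> = (\<integral>x. (\<Prod>i<k. K (x i) (x (Suc i))) * kernel_comp K L (x k) (x 0) \<partial>Pi\<^sub>M {..<Suc k} (\<lambda>_. M))"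
  proof (intro Bochner_Integration.integral_cong refl)
    fix x
    have eq: "?f (x(Suc k := y)) = (\<Prod>i<k. K (x i) (x (Suc i))) * (K (x k) y * L y (x 0))" for y
      by (simp add: mult_ac)
    show "(\<integral>y. ?f (x(Suc k := y)) \<partial>M) = (\<Prod>i<k. K (x i) (x (Suc i))) * kernel_comp K L (x k) (x 0)"
      unfolding eq kernel_comp_def by (rule integral_mult_right_zero)
  qed
  also have "\<dots> = kernel_trace (kernel_prod (replicate k K @ [kernel_comp K L]))"
    by (rule Suc.IH) (rule bounded_kernel_comp[OF K Suc.prems])
  also have "kernel_prod (replicate k K @ [kernel_comp K L]) = kernel_prod (replicate (Suc k) K @ [L])"
  proof -
    have "kernel_prod (replicate k K @ [kernel_comp K L]) = kernel_prod (replicate k K @ [K, L])"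
    proof (induction k)
      case (Suc k)
      then show ?case by (cases k) auto
    qed simp
    then show ?thesis by (simp add: replicate_app_Cons_same)
  qed
  finally show ?case .
qed

section \<open>Skew-symmetric kernels\<close>

locale skew_kernel = prob_space M for M :: "'a measure" +
  fixes B :: "'a \<Rightarrow> 'a \<Rightarrow> real"
  assumes B_measurable: "case_prod B \<in> borel_measurable (M \<Otimes>\<^sub>M M)"
    and B_bound: "x \<in> space M \<Longrightarrow> y \<in> space M \<Longrightarrow> \<bar>B x y\<bar> \<le> 1"
    and B_skew: "x \<in> space M \<Longrightarrow> y \<in> space M \<Longrightarrow> B y x = - B x y"
begin

definition A :: "'a \<Rightarrow> 'a \<Rightarrow> real" where "A x y = 1 + B x y"

definition ip :: "('a \<Rightarrow> real) \<Rightarrow> ('a \<Rightarrow> real) \<Rightarrow> real" where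
  "ip f g = (\<integral>x. f x * g x \<partial>M)"

definition moment :: "nat \<Rightarrow> real" where
  "moment i = (\<integral>x. (kernel_app B ^^ i) (\<lambda>_. 1) x \<partial>M)"

section \<open>The trace as a polynomial in moments\<close>

lemma bounded_kernel_B: "bounded_kernel B"
  by (rule bounded_kernelI[OF B_measurable B_bound])

lemma bounded_kernel_A: "bounded_kernel A"
  using bounded_kernel_add[OF bounded_kernel_const[of 1] bounded_kernel_B] by (simp add: A_def[abs_def])

lemma kernel_app_A:
  assumes "bounded_fun f" "x \<in> space M"
  shows "kernel_app A f x = (\<integral>y. f y \<partial>M) + kernel_app B f x"
  unfolding kernel_app_def A_def distrib_right mult_1
  using assms by (intro Bochner_Integration.integral_add bounded_fun_integrable kernel_app_integrand bounded_kernel_B)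

lemma kernel_app_lincomb:
  assumes K: "bounded_kernel K" and "bounded_fun f" "bounded_fun g" "x \<in> space M"
  shows "kernel_app K (\<lambda>y. c * f y + g y) x = c * kernel_app K f x + kernel_app K g x"
proof -
  have "integrable M (\<lambda>y. K x y * f y)" "integrable M (\<lambda>y. K x y * g y)"
    using assms by (auto intro!: bounded_fun_integrable kernel_app_integrand)
  then have "(\<integral>y. c * (K x y * f y) + K x y * g y \<partial>M) = c * kernel_app K f x + kernel_app K g x"
    by (simp add: kernel_app_def)
  then show ?thesis by (simp add: kernel_app_def algebra_simps)
qed

lemma bounded_fun_funpow_app:
  "bounded_kernel K \<Longrightarrow> bounded_fun f \<Longrightarrow> bounded_fun ((kernel_app K ^^ j) f)"
  by (induction j) (auto intro: bounded_fun_app)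

lemma funpow_kernel_app_cong:
  assumes "\<And>y. y \<in> space M \<Longrightarrow> f y = g y" "x \<in> space M"
  shows "(kernel_app K ^^ j) f x = (kernel_app K ^^ j) g x"
  using assms(2) by (induction j arbitrary: x) (auto intro: assms(1) kernel_app_cong)

lemma funpow_kernel_app_lincomb:
  assumes K: "bounded_kernel K" and f: "bounded_fun f" and g: "bounded_fun g" and "x \<in> space M"
  shows "(kernel_app K ^^ j) (\<lambda>y. c * f y + g y) x = c * (kernel_app K ^^ j) f x + (kernel_app K ^^ j) g x"
  using assms(4)
proof (induction j arbitrary: x)
  case (Suc j)
  have "(kernel_app K ^^ Suc j) (\<lambda>y. c * f y + g y) x
      = kernel_app K (\<lambda>y. c * (kernel_app K ^^ j) f y + (kernel_app K ^^ j) g y) x"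
    using Suc.IH by (auto intro: kernel_app_cong)
  also have "\<dots> = c * kernel_app K ((kernel_app K ^^ j) f) x + kernel_app K ((kernel_app K ^^ j) g) x"
    by (intro kernel_app_lincomb bounded_fun_funpow_app K f g Suc.prems)
  finally show ?case by simp
qed simp

lemma integral_walks:
  "(\<integral>x. (kernel_app A ^^ j) ((kernel_app B ^^ i) (\<lambda>_. 1)) x \<partial>M) = walk_moment moment j i"
proof (induction j arbitrary: i)
  case 0
  then show ?case by (simp add: moment_def)
next
  case (Suc j)
  let ?v = "\<lambda>i. (kernel_app B ^^ i) (\<lambda>_. 1)"
  have bv: "bounded_fun (?v i)" for i by (intro bounded_fun_funpow_app bounded_kernel_B bounded_fun_const)
  have "(\<integral>x. (kernel_app A ^^ Suc j) (?v i) x \<partial>M) = (\<integral>x. moment i * (kernel_app A ^^ j) (?v 0) x + (kernel_app A ^^ j) (?v (Suc i)) x \<partial>M)"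
  proof (rule Bochner_Integration.integral_cong[OF refl])
    fix x assume x: "x \<in> space M"
    \<comment> \<open>The innermost \<open>A\<close> is split, not the outermost: on B^i 1 its
      constant part gives \<open>moment i\<close> times 1 and its other part gives B^(i+1) 1, as in
      the recursion of \<open>walk_moment\<close>.\<close>
    have "(kernel_app A ^^ Suc j) (?v i) x = (kernel_app A ^^ j) (kernel_app A (?v i)) x"
      by (simp add: funpow_swap1)
    also have "\<dots> = (kernel_app A ^^ j) (\<lambda>y. moment i * ?v 0 y + ?v (Suc i) y) x"
      using kernel_app_A[OF bv] x by (intro funpow_kernel_app_cong) (auto simp: moment_def)
    also have "\<dots> = moment i * (kernel_app A ^^ j) (?v 0) x + (kernel_app A ^^ j) (?v (Suc i)) x"
      by (intro funpow_kernel_app_lincomb bounded_kernel_A bv x)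
    finally show "(kernel_app A ^^ Suc j) (?v i) x = moment i * (kernel_app A ^^ j) (?v 0) x + (kernel_app A ^^ j) (?v (Suc i)) x" .
  qed
  also have "\<dots> = moment i * (\<integral>x. (kernel_app A ^^ j) (?v 0) x \<partial>M) + (\<integral>x. (kernel_app A ^^ j) (?v (Suc i)) x \<partial>M)"
    by (subst Bochner_Integration.integral_add)
      (auto intro!: bounded_fun_integrable bounded_fun_cmult bounded_fun_funpow_app bounded_kernel_A bv bounded_fun_const simp del: funpow.simps)
  finally show ?case unfolding Suc by simp
qed

lemma foldr_replicate_walks:
  "foldr kernel_app (replicate j A @ replicate i B) f = (kernel_app A ^^ j) ((kernel_app B ^^ i) f)"
proof -
  have "foldr kernel_app (replicate i B) f = (kernel_app B ^^ i) f" for f by (induction i) auto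
  moreover have "foldr kernel_app (replicate j A) f = (kernel_app A ^^ j) f" for f by (induction j) auto
  ultimately show ?thesis by simp
qed

text \<open>The kernel counterpart of one step of the matrix telescope. The constant part of the
  first \<open>A\<close> integrates the remaining word over both arguments, which is a walk moment.
  The word behind that factor must be nonempty for lack of an identity kernel.\<close>

lemma kernel_trace_word_step:
  assumes "i + j > 0"
  shows "kernel_trace (kernel_prod (replicate (Suc j) A @ replicate i B))
      = walk_moment moment j i + kernel_trace (kernel_prod (replicate j A @ replicate (Suc i) B))"
proof -
  let ?xs = "replicate j A @ replicate i B"
  have ne: "?xs \<noteq> []" using assms by auto
  have bd: "bounded_kernel K" if "K \<in> set ?xs \<union> {B}" for K
    using that bounded_kernel_A bounded_kernel_B by (auto split: if_splits)
  define P where "P = kernel_prod ?xs"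
  have P: "bounded_kernel P" unfolding P_def by (rule bounded_kernel_prod) (use bd in blast)
  have "kernel_prod (replicate (Suc j) A @ replicate i B) = kernel_comp A P"
    using ne unfolding P_def by (cases ?xs) auto
  then have "kernel_trace (kernel_prod (replicate (Suc j) A @ replicate i B))
      = (\<integral>x. (\<integral>z. P z x \<partial>M) + kernel_comp B P x x \<partial>M)"
    unfolding kernel_trace_def
  proof (simp, intro Bochner_Integration.integral_cong refl)
    fix x assume x: "x \<in> space M"
    have "(\<integral>z. P z x + B x z * P z x \<partial>M) = (\<integral>z. P z x \<partial>M) + kernel_comp B P x x"
      unfolding kernel_comp_def
      by (intro Bochner_Integration.integral_add bounded_fun_integrable bounded_kernel_section(2)[OF P]
          kernel_comp_integrand bounded_kernel_B P x)
    then show "kernel_comp A P x x = (\<integral>z. P z x \<partial>M) + kernel_comp B P x x"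
      by (simp add: kernel_comp_def A_def algebra_simps)
  qed
  also have "\<dots> = (\<integral>x. \<integral>z. P z x \<partial>M \<partial>M) + kernel_trace (kernel_comp B P)"
  proof -
    have "bounded_fun (\<lambda>x. \<integral>z. P z x \<partial>M)"
      using bounded_fun_app[OF bounded_kernel_swap[OF P] bounded_fun_const[of 1]]
      by (simp add: kernel_app_def[abs_def])
    then show ?thesis
      unfolding kernel_trace_def
      by (intro Bochner_Integration.integral_add bounded_fun_integrable
          bounded_kernel_diag[OF bounded_kernel_comp[OF bounded_kernel_B P]])
  qed
  also have "(\<integral>x. \<integral>z. P z x \<partial>M \<partial>M) = (\<integral>z. \<integral>x. P z x \<partial>M \<partial>M)"
    by (rule integral_kernel_swap[OF bounded_kernel_swap[OF P]])
  also have "\<dots> = (\<integral>z. foldr kernel_app ?xs (\<lambda>_. 1) z \<partial>M)"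
  proof (intro Bochner_Integration.integral_cong refl)
    fix z assume z: "z \<in> space M"
    have "(\<integral>x. P z x \<partial>M) = kernel_app P (\<lambda>_. 1) z" by (simp add: kernel_app_def)
    also have "\<dots> = foldr kernel_app ?xs (\<lambda>_. 1) z"
      unfolding P_def by (rule kernel_app_prod[OF ne _ bounded_fun_const z]) (use bd in blast)
    finally show "(\<integral>x. P z x \<partial>M) = foldr kernel_app ?xs (\<lambda>_. 1) z" .
  qed
  also have "\<dots> = walk_moment moment j i"
    unfolding foldr_replicate_walks by (rule integral_walks)
  also have "kernel_comp B P = kernel_prod ([B] @ ?xs)"
    using ne unfolding P_def by (cases ?xs) auto
  \<comment> \<open>Cyclicity of the trace moves the new \<open>B\<close> to the run at the
    end.\<close>
  also have "kernel_trace (kernel_prod ([B] @ ?xs)) = kernel_trace (kernel_prod (?xs @ [B]))"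
    by (rule kernel_trace_prod_rotate[OF _ ne]) (use bd in auto)
  also have "?xs @ [B] = replicate j A @ replicate (Suc i) B"
    by (simp add: replicate_append_same)
  finally show ?thesis .
qed

text \<open>Transposing reverses the order of the factors; as all of them are \<open>B\<close>, only
  their signs remain.\<close>

lemma kernel_prod_B_transpose:
  assumes "x \<in> space M" "y \<in> space M" "k > 0"
  shows "kernel_prod (replicate k B) y x = (-1) ^ k * kernel_prod (replicate k B) x y"
  using assms(3,1,2)
proof (induction k arbitrary: x y rule: nat_induct_non_zero)
  case 1
  then show ?case using B_skew[of x y] by simp
next
  case (Suc k)
  let ?P = "kernel_prod (replicate k B)"
  have ne: "replicate k B \<noteq> []" using Suc.hyps by simp
  have "kernel_prod (replicate (Suc k) B) y x = kernel_comp B ?P y x"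
    using kernel_prod_append[of "[B]" "replicate k B" y x] ne bounded_kernel_B Suc.prems by simp
  also have "\<dots> = (\<integral>z. (-1) ^ Suc k * (?P x z * B z y) \<partial>M)"
    unfolding kernel_comp_def
  proof (intro Bochner_Integration.integral_cong refl)
    fix z assume z: "z \<in> space M"
    show "B y z * ?P z x = (-1) ^ Suc k * (?P x z * B z y)"
      using Suc.IH[OF Suc.prems(1) z] B_skew[OF z Suc.prems(2)] by simp
  qed
  also have "\<dots> = (-1) ^ Suc k * kernel_comp ?P B x y"
    by (simp add: kernel_comp_def)
  also have "kernel_comp ?P B x y = kernel_prod (replicate k B @ [B]) x y"
    using kernel_prod_append[of "replicate k B" "[B]" x y] ne bounded_kernel_B Suc.prems by simp
  finally show ?case by (simp add: replicate_append_same)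
qed

theorem kernel_trace_eq_cycle_moment:
  assumes l: "odd l" "l \<ge> 3"
  shows "kernel_trace (kernel_prod (replicate l A)) = cycle_moment moment l"
proof -
  \<comment> \<open>Total length at least 2 keeps a nonempty word behind every factor that is
    split.\<close>
  have tele: "kernel_trace (kernel_prod (replicate j A @ replicate i B))
      = (\<Sum>k<j. walk_moment moment k (i + j - 1 - k)) + kernel_trace (kernel_prod (replicate (i + j) B))"
    if "i + j \<ge> 2" for i j
    using that
  proof (induction j arbitrary: i)
    case (Suc j)
    have "kernel_trace (kernel_prod (replicate (Suc j) A @ replicate i B))
      = walk_moment moment j i + kernel_trace (kernel_prod (replicate j A @ replicate (Suc i) B))"
      by (rule kernel_trace_word_step) (use Suc.prems in linarith)
    also have "\<dots> = walk_moment moment j i + ((\<Sum>k<j. walk_moment moment k (Suc i + j - 1 - k))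
        + kernel_trace (kernel_prod (replicate (Suc i + j) B)))"
      using Suc.IH[of "Suc i"] Suc.prems by simp
    finally show ?case by simp
  qed simp
  have "kernel_trace (kernel_prod (replicate l B)) = (\<integral>x. 0 \<partial>M)"
    unfolding kernel_trace_def
  proof (intro Bochner_Integration.integral_cong refl)
    fix x assume "x \<in> space M"
    then have "kernel_prod (replicate l B) x x = - kernel_prod (replicate l B) x x"
      using kernel_prod_B_transpose[of x x l] l by simp
    then show "kernel_prod (replicate l B) x x = 0" by simp
  qed
  then show ?thesis using tele[of 0 l] l by (simp add: cycle_moment_def)
qed

section \<open>The inner product and skew-adjointness of \<open>B\<close>\<close>

lemma ip_commute: "ip f g = ip g f"
  by (simp add: ip_def mult.commute)

lemma ip_lincomb:
  assumes "bounded_fun f" "bounded_fun g" "bounded_fun h"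
  shows "ip (\<lambda>x. c * f x + g x) h = c * ip f h + ip g h"
proof -
  have "integrable M (\<lambda>x. f x * h x)" "integrable M (\<lambda>x. g x * h x)"
    using assms by (auto intro!: bounded_fun_integrable bounded_fun_mult)
  then have "(\<integral>x. c * (f x * h x) + g x * h x \<partial>M) = c * ip f h + ip g h" by (simp add: ip_def)
  then show ?thesis by (simp add: ip_def algebra_simps)
qed

lemma ip_cmult: "ip (\<lambda>x. c * f x) h = c * ip f h"
  by (simp add: ip_def mult.assoc)

lemma ip_diff:
  assumes "bounded_fun f" "bounded_fun g" "bounded_fun h"
  shows "ip (\<lambda>x. f x - g x) h = ip f h - ip g h"
  using ip_lincomb[OF assms(2,1,3), of "-1"] by simp

lemma ip_sum:
  assumes "finite I" "\<And>i. i \<in> I \<Longrightarrow> bounded_fun (f i)" "bounded_fun h"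
  shows "ip (\<lambda>x. \<Sum>i\<in>I. c i * f i x) h = (\<Sum>i\<in>I. c i * ip (f i) h)"
  using assms
proof (induction I rule: finite_induct)
  case (insert i I)
  then have "ip (\<lambda>x. c i * f i x + (\<Sum>i\<in>I. c i * f i x)) h = c i * ip (f i) h + ip (\<lambda>x. \<Sum>i\<in>I. c i * f i x) h"
    by (intro ip_lincomb bounded_fun_sum bounded_fun_cmult) auto
  with insert show ?case by simp
qed (simp add: ip_def)

lemma ip_nonneg: "ip f f \<ge> 0"
  by (simp add: ip_def)

lemma ip_self_eq_0_iff:
  assumes "bounded_fun f"
  shows "ip f f = 0 \<longleftrightarrow> (AE x in M. f x = 0)"
proof -
  have "integrable M (\<lambda>x. f x * f x)" using assms by (auto intro!: bounded_fun_integrable bounded_fun_mult)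
  then show ?thesis unfolding ip_def by (subst integral_nonneg_eq_0_iff_AE) auto
qed

lemma ip_null:
  assumes f: "bounded_fun f" and h: "bounded_fun h" and "ip f f = 0"
  shows "ip f h = 0"
proof -
  have "AE x in M. f x * h x = 0" using assms ip_self_eq_0_iff[OF f] by auto
  then have "(\<integral>x. f x * h x \<partial>M) = (\<integral>x. 0 \<partial>M)"
    using bounded_fun_mult[OF f h] by (intro integral_cong_AE) (auto dest: bounded_fun_measurable)
  then show ?thesis by (simp add: ip_def)
qed

lemma ip_app_B:
  assumes f: "bounded_fun f" and g: "bounded_fun g"
  shows "ip (kernel_app B f) g = - ip f (kernel_app B g)"
proof -
  have "ip (kernel_app B f) g = (\<integral>x. \<integral>y. B x y * f y * g x \<partial>M \<partial>M)"
    unfolding ip_def kernel_app_def by simp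
  also have "\<dots> = (\<integral>y. \<integral>x. B x y * f y * g x \<partial>M \<partial>M)"
    by (intro integral_kernel_swap bounded_kernel_mult bounded_kernel_B bounded_kernel_left g
        bounded_kernel_swap[OF bounded_kernel_left[OF f]])
  also have "\<dots> = (\<integral>y. - (f y * (\<integral>x. B y x * g x \<partial>M)) \<partial>M)"
  proof (intro Bochner_Integration.integral_cong refl)
    fix y assume y: "y \<in> space M"
    have "(\<integral>x. B x y * f y * g x \<partial>M) = (\<integral>x. - f y * (B y x * g x) \<partial>M)"
      using B_skew[OF y] by (intro Bochner_Integration.integral_cong refl) simp
    then show "(\<integral>x. B x y * f y * g x \<partial>M) = - (f y * (\<integral>x. B y x * g x \<partial>M))" by simp
  qed
  finally show ?thesis by (simp add: ip_def kernel_app_def)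
qed

text \<open>Gram--Schmidt along the orbit of \<open>1\<close> under \<open>B\<close>. Once the orbit closes up, the remainder has
  norm 0 and the junk value of division by 0 makes all further vectors 0.\<close>

definition remainder :: "(nat \<Rightarrow> 'a \<Rightarrow> real) \<Rightarrow> nat \<Rightarrow> 'a \<Rightarrow> real" where
  "remainder e k x = kernel_app B (e k) x - (\<Sum>i\<le>k. ip (e i) (kernel_app B (e k)) * e i x)"

text \<open>Each vector depends on all earlier ones, so the recursion runs on growing lists, and the
  sequence is read off as their last entries.\<close>

lemma gram_schmidt_exists:
  "\<exists>e. e 0 = (\<lambda>_. 1) \<and> (\<forall>k. e (Suc k) = (\<lambda>x. inverse (sqrt (ip (remainder e k) (remainder e k))) * remainder e k x))"
proof -
  define step where "step k es x = (let e = (\<lambda>i. es ! i) in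
    inverse (sqrt (ip (remainder e k) (remainder e k))) * remainder e k x)" for k es x
  define es where "es = rec_nat [\<lambda>_. 1] (\<lambda>k es. es @ [step k es])"
  have es0: "es 0 = [\<lambda>_. 1]" and esS: "es (Suc k) = es k @ [step k (es k)]" for k
    by (simp_all add: es_def)
  have len: "length (es k) = Suc k" for k by (induction k) (auto simp: es0 esS)
  have nth: "es (k + m) ! i = es k ! i" if "i \<le> k" for k m i
    using that by (induction m) (auto simp: esS nth_append len)
  define e where "e k = es k ! k" for k
  have e_nth: "es k ! i = e i" if "i \<le> k" for i k
    using nth[of i i "k - i"] that by (simp add: e_def)
  have "remainder (\<lambda>i. es k ! i) k = remainder e k" for k
    unfolding remainder_def by (auto simp: e_nth intro!: sum.cong)
  then have "e (Suc k) = (\<lambda>x. inverse (sqrt (ip (remainder e k) (remainder e k))) * remainder e k x)" for k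
    unfolding e_def[of "Suc k"] esS by (auto simp: nth_append len step_def Let_def)
  moreover have "e 0 = (\<lambda>_. 1)" by (simp add: e_def es0)
  ultimately show ?thesis by blast
qed

definition e :: "nat \<Rightarrow> 'a \<Rightarrow> real" where
  "e = (SOME e. e 0 = (\<lambda>_. 1) \<and> (\<forall>k. e (Suc k) =
      (\<lambda>x. inverse (sqrt (ip (remainder e k) (remainder e k))) * remainder e k x)))"

lemma e_0: "e 0 = (\<lambda>_. 1)"
  and e_Suc: "e (Suc k) = (\<lambda>x. inverse (sqrt (ip (remainder e k) (remainder e k))) * remainder e k x)"
  using someI_ex[OF gram_schmidt_exists] unfolding e_def[symmetric] by blast+

definition t :: "nat \<Rightarrow> nat \<Rightarrow> real" where
  "t i j = ip (e i) (kernel_app B (e j))"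

lemma bounded_fun_e: "bounded_fun (e k)"
proof (induction k rule: less_induct)
  case (less k)
  show ?case
  proof (cases k)
    case 0
    then show ?thesis by (simp add: e_0 bounded_fun_const)
  next
    case (Suc m)
    have "bounded_fun (remainder e m)"
      unfolding remainder_def[abs_def] using less Suc
      by (intro bounded_fun_diff bounded_fun_sum bounded_fun_cmult bounded_fun_app bounded_kernel_B) auto
    then show ?thesis unfolding Suc e_Suc by (rule bounded_fun_cmult)
  qed
qed

lemma bounded_fun_Be: "bounded_fun (kernel_app B (e k))"
  by (rule bounded_fun_app[OF bounded_kernel_B bounded_fun_e])

lemma bounded_fun_remainder: "bounded_fun (remainder e k)"
  unfolding remainder_def[abs_def]
  by (intro bounded_fun_diff bounded_fun_sum bounded_fun_cmult bounded_fun_Be bounded_fun_e)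

lemma ip_remainder:
  assumes "bounded_fun h"
  shows "ip (remainder e k) h = ip (kernel_app B (e k)) h - (\<Sum>i\<le>k. t i k * ip (e i) h)"
  unfolding remainder_def[abs_def] t_def
  by (subst ip_diff) (auto simp: ip_sum bounded_fun_e assms intro!: bounded_fun_Be bounded_fun_sum bounded_fun_cmult bounded_fun_e)

lemma ip_e_self: "ip (e k) (e k) = 0 \<or> ip (e k) (e k) = 1"
proof (cases k)
  case 0
  then show ?thesis by (simp add: e_0 ip_def prob_space)
next
  case (Suc m)
  let ?r = "remainder e m"
  have "ip (e k) (e k) = inverse (sqrt (ip ?r ?r)) * (inverse (sqrt (ip ?r ?r)) * ip ?r ?r)"
    unfolding Suc e_Suc ip_cmult by (subst ip_commute) (simp only: ip_cmult)
  then show ?thesis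
    using ip_nonneg[of ?r] by (cases "ip ?r ?r = 0") (auto simp: field_simps)
qed

text \<open>Replaces normalization: if \<open>e k\<close> has norm 0, then both sides vanish. Every
  later use of orthonormality goes through this identity, so the closing up of the orbit needs no
  separate case.\<close>

lemma ip_e_self_mult:
  assumes "bounded_fun h"
  shows "ip (e k) (e k) * ip (e k) h = ip (e k) h"
  using ip_e_self[of k] ip_null[OF bounded_fun_e assms, of k] by auto

lemma ip_e_orthogonal: "i < k \<Longrightarrow> ip (e k) (e i) = 0"
proof (induction k arbitrary: i rule: less_induct)
  case (less k)
  then obtain m where m: "k = Suc m" by (cases k) auto
  have orth: "ip (e p) (e q) = 0" if "p \<le> m" "q \<le> m" "p \<noteq> q" for p q
    using less.IH[of p q] less.IH[of q p] that m by (cases "q < p") (auto simp: ip_commute)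
  have "i \<le> m" using less m by simp
  have "(\<Sum>p\<le>m. t p m * ip (e p) (e i)) = (\<Sum>p\<in>{i}. t p m * ip (e p) (e i))"
    using orth \<open>i \<le> m\<close> by (intro sum.mono_neutral_right) auto
  also have "\<dots> = t i m" using ip_e_self_mult[OF bounded_fun_Be] by (simp add: t_def mult.commute)
  finally have "ip (remainder e m) (e i) = 0"
    unfolding ip_remainder[OF bounded_fun_e] by (simp add: t_def ip_commute)
  then show ?case unfolding m e_Suc ip_cmult by simp
qed

lemma ip_e: "i \<noteq> k \<Longrightarrow> ip (e i) (e k) = 0"
  by (metis ip_commute ip_e_orthogonal nat_neq_iff)

lemma t_skew: "t i j = - t j i"
  unfolding t_def using ip_app_B[OF bounded_fun_e[of i] bounded_fun_e[of j]] by (simp add: ip_commute)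

text \<open>Says that B e_k is a combination of e_0, ..., e_(k+1). It is tested against
  \<open>h\<close> because as an identity of functions it can fail on a null set, in particular once
  the remainder has norm 0.\<close>

lemma ip_Be_expand:
  assumes h: "bounded_fun h"
  shows "ip (kernel_app B (e k)) h = (\<Sum>i\<le>Suc k. t i k * ip (e i) h)"
proof -
  let ?r = "remainder e k"
  define a where "a = sqrt (ip ?r ?r)"
  have r: "ip ?r h = a * ip (e (Suc k)) h" if "bounded_fun h" for h
  proof (cases "ip ?r ?r = 0")
    case True
    then show ?thesis using ip_null[OF bounded_fun_remainder that] by (simp add: a_def)
  next
    case False
    then show ?thesis unfolding e_Suc ip_cmult by (simp add: a_def)
  qed
  have "t (Suc k) k = ip (kernel_app B (e k)) (e (Suc k))" by (simp add: t_def ip_commute)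
  also have "\<dots> = ip ?r (e (Suc k)) + (\<Sum>i\<le>k. t i k * ip (e i) (e (Suc k)))"
    using ip_remainder[OF bounded_fun_e] by simp
  also have "(\<Sum>i\<le>k. t i k * ip (e i) (e (Suc k))) = 0"
    by (intro sum.neutral) (auto simp: ip_e)
  \<comment> \<open>The subdiagonal coefficient is the norm \<open>a\<close> of the remainder, or 0
    if the orbit has closed up.\<close>
  finally have t: "t (Suc k) k = a * ip (e (Suc k)) (e (Suc k))" using r[OF bounded_fun_e] by simp
  have "t (Suc k) k * ip (e (Suc k)) h = ip ?r h"
    unfolding t r[OF h] using ip_e_self_mult[OF h, of "Suc k"] by (simp add: mult.assoc)
  then show ?thesis using ip_remainder[OF h, of k] by simp
qed

text \<open>The matrix is Hessenberg, so each application of it reaches at most one further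
  coordinate; this is what makes truncation to finite size exact for low powers.\<close>

lemma t_eq_0: "i > Suc j \<Longrightarrow> t i j = 0"
proof -
  assume "i > Suc j"
  then have "(\<Sum>p\<le>Suc j. t p j * ip (e p) (e i)) = 0"
    by (intro sum.neutral) (auto simp: ip_e)
  then show ?thesis using ip_Be_expand[OF bounded_fun_e, of j i] by (simp add: t_def ip_commute)
qed

text \<open>The classical argument through the squared distance to the projection \<open>s\<close>,
  for orthogonal vectors of norm 0 or 1.\<close>

lemma bessel:
  assumes g: "bounded_fun g"
  shows "(\<Sum>i<n. (ip (e i) g)\<^sup>2) \<le> ip g g"
proof -
  define c where "c i = ip (e i) g" for i
  define s where "s x = (\<Sum>i<n. c i * e i x)" for x
  have s: "bounded_fun s" unfolding s_def[abs_def] by (intro bounded_fun_sum bounded_fun_cmult bounded_fun_e)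
  have sh: "ip s h = (\<Sum>i<n. c i * ip (e i) h)" if "bounded_fun h" for h
    unfolding s_def[abs_def] by (rule ip_sum) (auto simp: bounded_fun_e that)
  have sg: "ip s g = (\<Sum>i<n. (c i)\<^sup>2)" using sh[OF g] by (simp add: c_def power2_eq_square)
  have es: "ip (e i) s = c i" if "i < n" for i
  proof -
    have "ip (e i) s = (\<Sum>j<n. c j * ip (e j) (e i))" using sh[OF bounded_fun_e] by (simp add: ip_commute)
    also have "\<dots> = (\<Sum>j\<in>{i}. c j * ip (e j) (e i))"
      using that by (intro sum.mono_neutral_right) (auto simp: ip_e)
    also have "\<dots> = c i" using ip_e_self_mult[OF g, of i] by (simp add: c_def mult.commute)
    finally show ?thesis .
  qed
  have ss: "ip s s = (\<Sum>i<n. (c i)\<^sup>2)"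
    unfolding sh[OF s] power2_eq_square by (intro sum.cong refl) (simp add: es)
  let ?d = "\<lambda>x. g x - s x"
  have d: "bounded_fun ?d" by (rule bounded_fun_diff[OF g s])
  have "ip ?d ?d = ip g ?d - ip s ?d" by (rule ip_diff[OF g s d])
  also have "\<dots> = (ip g g - ip s g) - (ip g s - ip s s)"
    unfolding ip_commute[of _ ?d] ip_diff[OF g s g] ip_diff[OF g s s] by simp
  also have "\<dots> = ip g g - (\<Sum>i<n. (c i)\<^sup>2)" using sg ss by (simp add: ip_commute)
  finally show ?thesis using ip_nonneg[of ?d] by (simp add: c_def)
qed

text \<open>Bessel is used twice: for the columns B e_j, and then for the section \<open>B x\<close>
  at each point x, since (B e_j)(x) is the inner product of e_j with that section. The section has
  squared norm at most 1.\<close>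

lemma t_hilbert_schmidt: "(\<Sum>i<n. \<Sum>j<n. (t i j)\<^sup>2) \<le> 1"
proof -
  have "(\<Sum>i<n. \<Sum>j<n. (t i j)\<^sup>2) = (\<Sum>j<n. \<Sum>i<n. (ip (e i) (kernel_app B (e j)))\<^sup>2)"
    unfolding t_def by (rule sum.swap)
  also have "\<dots> \<le> (\<Sum>j<n. ip (kernel_app B (e j)) (kernel_app B (e j)))"
    by (intro sum_mono bessel bounded_fun_Be)
  also have "\<dots> = (\<integral>x. (\<Sum>j<n. kernel_app B (e j) x * kernel_app B (e j) x) \<partial>M)"
    unfolding ip_def
    by (rule Bochner_Integration.integral_sum[symmetric]) (auto intro!: bounded_fun_integrable bounded_fun_mult bounded_fun_Be)
  also have "\<dots> \<le> (\<integral>x. 1 \<partial>M)"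
  proof (rule integral_mono)
    show "integrable M (\<lambda>x. \<Sum>j<n. kernel_app B (e j) x * kernel_app B (e j) x)"
      by (intro bounded_fun_integrable bounded_fun_sum bounded_fun_mult bounded_fun_Be)
    fix x assume x: "x \<in> space M"
    have Bx: "bounded_fun (B x)" by (rule bounded_kernel_section(1)[OF bounded_kernel_B x])
    have "(\<Sum>j<n. kernel_app B (e j) x * kernel_app B (e j) x) = (\<Sum>j<n. (ip (e j) (B x))\<^sup>2)"
      by (simp add: kernel_app_def ip_def power2_eq_square mult.commute)
    also have "\<dots> \<le> ip (B x) (B x)" by (rule bessel[OF Bx])
    also have "\<dots> \<le> 1"
    proof -
      have "\<bar>B x y * B x y\<bar> \<le> 1" if "y \<in> space M" for y
        using B_bound[OF x that] by (simp add: power2_eq_square[symmetric] abs_square_le_1)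
      then have "\<bar>\<integral>y. B x y * B x y \<partial>M\<bar> \<le> 1"
        by (rule abs_integral_le_bound[OF bounded_fun_mult[OF Bx Bx]])
      then show ?thesis unfolding ip_def by linarith
    qed
    finally show "(\<Sum>j<n. kernel_app B (e j) x * kernel_app B (e j) x) \<le> 1" .
  qed simp
  finally show ?thesis by (simp add: prob_space)
qed

text \<open>The coordinates of B^i 1 are the column \<open>c i\<close> of T^i. It is supported on
  indices up to i, so cutting \<open>t\<close> to size n loses nothing while i < n.\<close>

lemma moment_eq_matrix_entry:
  assumes "k < n"
  shows "moment k = (mat n n (\<lambda>(i, j). t i j) ^\<^sub>m k) $$ (0, 0)"
proof -
  define T where "T = mat n n (\<lambda>(i, j). t i j)"
  have T: "T \<in> carrier_mat n n" by (simp add: T_def)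
  have n: "n > 0" using assms by simp
  define v where "v i = (kernel_app B ^^ i) (\<lambda>_. 1)" for i
  have v: "bounded_fun (v i)" for i
    unfolding v_def by (intro bounded_fun_funpow_app bounded_kernel_B bounded_fun_const)
  define c where "c i p = (T ^\<^sub>m i) $$ (p, 0)" for i p
  have c_0: "c 0 p = (if p = 0 then 1 else 0)" if "p < n" for p
    using that T by (simp add: c_def)
  have c_Suc: "c (Suc i) p = (\<Sum>q<n. t p q * c i q)" if "p < n" for i p
  proof -
    have "c (Suc i) p = (\<Sum>q<n. T $$ (p, q) * (T ^\<^sub>m i) $$ (q, 0))"
      unfolding c_def pow_mat_Suc_left[OF T]
      by (rule index_mult_mat_sum[OF T pow_carrier_mat[OF T] that n])
    then show ?thesis using that by (simp add: T_def c_def)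
  qed
  have supp: "c i p = 0" if "i < p" "p < n" for i p
    using that
  proof (induction i arbitrary: p)
    case 0
    then show ?case by (simp add: c_0)
  next
    case (Suc i)
    have "t p q * c i q = 0" if "q < n" for q
      using Suc that t_eq_0[of q p] by (cases "q \<le> i") auto
    then show ?case unfolding c_Suc[OF Suc.prems(2)] by (intro sum.neutral) auto
  qed
  have expand: "ip (v i) h = (\<Sum>p<n. c i p * ip (e p) h)" if "i < n" "bounded_fun h" for i h
    using that
  proof (induction i arbitrary: h)
    case 0
    have "(\<Sum>p<n. c 0 p * ip (e p) h) = (\<Sum>p<n. if p = 0 then ip (e p) h else 0)"
      by (intro sum.cong refl) (auto simp: c_0)
    then show ?case using n by (simp add: v_def e_0)
  next
    case (Suc i)
    have Bh: "bounded_fun (kernel_app B h)" using Suc.prems by (intro bounded_fun_app bounded_kernel_B)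
    \<comment> \<open>Skew-adjointness shifts \<open>B\<close> to the test function, where the
      induction hypothesis applies, and then back to the vectors \<open>e q\<close>.\<close>
    have "ip (v (Suc i)) h = - ip (v i) (kernel_app B h)"
      using ip_app_B[OF v Suc.prems(2), of i] by (simp add: v_def)
    also have "\<dots> = (\<Sum>q<n. c i q * ip (kernel_app B (e q)) h)"
      using Suc.IH[OF _ Bh] Suc.prems by (simp add: ip_app_B[OF bounded_fun_e] sum_negf)
    also have "\<dots> = (\<Sum>q<n. \<Sum>p<n. c i q * (t p q * ip (e p) h))"
    proof (intro sum.cong refl)
      fix q assume "q \<in> {..<n}"
      show "c i q * ip (kernel_app B (e q)) h = (\<Sum>p<n. c i q * (t p q * ip (e p) h))"
      proof (cases "q \<le> i")
        case True
        then have "(\<Sum>p\<le>Suc q. t p q * ip (e p) h) = (\<Sum>p<n. t p q * ip (e p) h)"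
          using Suc.prems by (intro sum.mono_neutral_left) (auto simp: t_eq_0)
        then show ?thesis using ip_Be_expand[OF Suc.prems(2), of q] by (simp add: sum_distrib_left)
      next
        case False
        then show ?thesis using supp[of i q] \<open>q \<in> _\<close> by simp
      qed
    qed
    also have "\<dots> = (\<Sum>p<n. \<Sum>q<n. c i q * (t p q * ip (e p) h))" by (rule sum.swap)
    also have "\<dots> = (\<Sum>p<n. c (Suc i) p * ip (e p) h)"
      by (intro sum.cong refl) (simp add: c_Suc sum_distrib_right sum_distrib_left mult_ac)
    finally show ?case .
  qed
  have "moment k = ip (v k) (e 0)" by (simp add: moment_def ip_def v_def e_0)
  also have "\<dots> = (\<Sum>p<n. c k p * ip (e p) (e 0))" by (rule expand[OF assms bounded_fun_e])
  also have "\<dots> = (\<Sum>p\<in>{0}. c k p * ip (e p) (e 0))"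
    using n by (intro sum.mono_neutral_right) (auto simp: ip_e)
  also have "\<dots> = c k 0" by (simp add: e_0 ip_def prob_space)
  finally show ?thesis by (simp add: c_def T_def)
qed

theorem cycle_moment_le_1:
  assumes l: "odd l" "l \<ge> 3"
  shows "cycle_moment moment l \<le> 1"
    and "cycle_moment moment l = 1 \<longleftrightarrow> (AE x in M. kernel_app B (\<lambda>_. 1) x = 0)"
proof -
  \<comment> \<open>Size l suffices, since \<open>cycle_moment\<close> reads only moments of index
    below l.\<close>
  define b where "b k = (mat l l (\<lambda>(i, j). t i j) ^\<^sub>m k) $$ (0, 0)" for k
  have l0: "l > 0" using l by simp
  have cm: "cycle_moment moment l = cycle_moment b l"
    by (rule cycle_moment_cong) (simp add: b_def moment_eq_matrix_entry)
  show "cycle_moment moment l \<le> 1"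
    unfolding cm b_def[abs_def] by (rule skew_cycle_moment_bound(1)[OF l0 t_skew t_hilbert_schmidt l])
  have B1: "bounded_fun (kernel_app B (\<lambda>_. 1))" by (intro bounded_fun_app bounded_kernel_B bounded_fun_const)
  show "cycle_moment moment l = 1 \<longleftrightarrow> (AE x in M. kernel_app B (\<lambda>_. 1) x = 0)"
  proof
    assume "cycle_moment moment l = 1"
    then have "t i 0 = 0" if "i < l" for i
      using skew_cycle_moment_bound(2)[OF l0 t_skew t_hilbert_schmidt l _ that] unfolding cm b_def[abs_def] by simp
    \<comment> \<open>A vanishing first column of \<open>t\<close> makes the expansion of B 1
      trivial, so B 1 has norm 0.\<close>
    then have "ip (kernel_app B (e 0)) (kernel_app B (e 0)) = 0"
      unfolding ip_Be_expand[OF bounded_fun_Be] using l by (intro sum.neutral) auto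
    then show "AE x in M. kernel_app B (\<lambda>_. 1) x = 0"
      using ip_self_eq_0_iff[OF B1] by (simp add: e_0)
  next
    assume "AE x in M. kernel_app B (\<lambda>_. 1) x = 0"
    then have null: "ip (kernel_app B (\<lambda>_. 1)) (kernel_app B (\<lambda>_. 1)) = 0"
      using ip_self_eq_0_iff[OF B1] by simp
    show "cycle_moment moment l = 1"
    proof (rule cycle_moment_trivial[OF _ _ l0])
      show "moment 0 = 1" by (simp add: moment_def prob_space)
      fix k :: nat assume "k > 0"
      then obtain m where m: "k = Suc m" by (cases k) auto
      have bm: "bounded_fun ((kernel_app B ^^ m) (\<lambda>_. 1))"
        by (intro bounded_fun_funpow_app bounded_kernel_B bounded_fun_const)
      have "moment k = ip (kernel_app B ((kernel_app B ^^ m) (\<lambda>_. 1))) (\<lambda>_. 1)"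
        by (simp add: m moment_def ip_def)
      also have "\<dots> = - ip (kernel_app B (\<lambda>_. 1)) ((kernel_app B ^^ m) (\<lambda>_. 1))"
        using ip_app_B[OF bm bounded_fun_const] by (simp add: ip_commute)
      also have "\<dots> = 0" using ip_null[OF B1 bm null] by simp
      finally show "moment k = 0" .
    qed
  qed
qed

end

section \<open>Counting cycles in tournaments\<close>

definition cycle_arcs :: "nat \<Rightarrow> (nat \<Rightarrow> 'a) \<Rightarrow> ('a \<times> 'a) set" where
  "cycle_arcs l v = (\<lambda>i. (v i, v (Suc i mod l))) ` {..<l}"

text \<open>Sequences, unlike arc sets, correspond to boxes in the cube. Extensionality keeps the
  set finite.\<close>

definition cyclic_seqs :: "'a set \<Rightarrow> ('a \<times> 'a) set \<Rightarrow> nat \<Rightarrow> (nat \<Rightarrow> 'a) set" where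
  "cyclic_seqs V E l = {v \<in> {..<l} \<rightarrow>\<^sub>E V. inj_on v {..<l} \<and> cycle_arcs l v \<subseteq> E}"

lemma cyclic_seqs_iff:
  "v \<in> cyclic_seqs V E l \<longleftrightarrow>
    v \<in> {..<l} \<rightarrow>\<^sub>E V \<and> inj_on v {..<l} \<and> (\<forall>i<l. (v i, v (Suc i mod l)) \<in> E)"
  by (auto simp: cyclic_seqs_def cycle_arcs_def)

lemma directed_cycles_eq:
  assumes "E \<subseteq> V \<times> V" "l > 0"
  shows "directed_cycles E l = cycle_arcs l ` cyclic_seqs V E l"
proof (intro equalityI subsetI)
  fix c assume "c \<in> directed_cycles E l"
  then obtain v where v: "c = cycle_arcs l v" "inj_on v {..<l}" "\<forall>i<l. (v i, v (Suc i mod l)) \<in> E"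
    by (auto simp: directed_cycles_def cycle_arcs_def)
  let ?w = "restrict v {..<l}"
  have "cycle_arcs l ?w = c" using assms v by (auto simp: cycle_arcs_def)
  moreover have "?w \<in> cyclic_seqs V E l"
    unfolding cyclic_seqs_iff using assms v by (auto simp: inj_on_def)
  ultimately show "c \<in> cycle_arcs l ` cyclic_seqs V E l" by blast
qed (auto simp: directed_cycles_def cycle_arcs_def cyclic_seqs_iff)

text \<open>The arc set determines the successor of every vertex, so a sequence with these arcs is
  fixed by its starting vertex: the fibers of \<open>cycle_arcs\<close> are the l distinct
  rotations.\<close>

lemma card_cyclic_seqs:
  assumes V: "finite V" and E: "E \<subseteq> V \<times> V" and l: "l > 0"
  shows "card (cyclic_seqs V E l) = l * card (directed_cycles E l)"
proof -
  let ?X = "cyclic_seqs V E l"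
  have fin: "finite ?X"
    by (rule finite_subset[of _ "{..<l} \<rightarrow>\<^sub>E V"]) (auto simp: cyclic_seqs_def intro!: finite_PiE V)
  have fiber: "card {v \<in> ?X. cycle_arcs l v = cycle_arcs l w} = l" if w: "w \<in> ?X" for w
  proof -
    have inj: "inj_on w {..<l}" and wV: "w \<in> {..<l} \<rightarrow>\<^sub>E V"
      and wE: "\<And>i. i < l \<Longrightarrow> (w i, w (Suc i mod l)) \<in> E"
      using w by (auto simp: cyclic_seqs_iff)
    define rot where "rot k = restrict (\<lambda>i. w ((i + k) mod l)) {..<l}" for k
    have "{v \<in> ?X. cycle_arcs l v = cycle_arcs l w} = rot ` {..<l}"
    proof (intro equalityI subsetI)
      fix v assume "v \<in> {v \<in> ?X. cycle_arcs l v = cycle_arcs l w}"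
      then have v: "v \<in> {..<l} \<rightarrow>\<^sub>E V" "cycle_arcs l v = cycle_arcs l w" by (auto simp: cyclic_seqs_iff)
      have step: "\<exists>j<l. v i = w j \<and> v (Suc i mod l) = w (Suc j mod l)" if "i < l" for i
      proof -
        have "(v i, v (Suc i mod l)) \<in> cycle_arcs l w"
          unfolding v(2)[symmetric] using that by (auto simp: cycle_arcs_def)
        then show ?thesis by (auto simp: cycle_arcs_def)
      qed
      from step[OF l] obtain k where k: "k < l" "v 0 = w k" by auto
      have "v i = w ((i + k) mod l)" if "i < l" for i
        using that
      proof (induction i)
        case 0
        then show ?case using k by simp
      next
        case (Suc i)
        from step[of i] Suc.prems obtain j where j: "j < l" "v i = w j" "v (Suc i mod l) = w (Suc j mod l)"
          by auto
        have "w j = w ((i + k) mod l)" using Suc j by simp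
        then have "j = (i + k) mod l" using inj j l by (auto dest: inj_onD)
        then show ?case using j(3) Suc.prems by (simp add: mod_Suc_eq)
      qed
      then have "v = rot k"
        using v(1) by (intro extensionalityI[of _ "{..<l}"]) (auto simp: rot_def PiE_def)
      then show "v \<in> rot ` {..<l}" using k by blast
    next
      fix v assume "v \<in> rot ` {..<l}"
      then obtain k where k: "k < l" "v = rot k" by auto
      have vi: "v i = w ((i + k) mod l)" if "i < l" for i using that k by (simp add: rot_def)
      have vS: "v (Suc i mod l) = w (Suc ((i + k) mod l) mod l)" for i
        using vi[of "Suc i mod l"] l by (simp add: mod_Suc_eq mod_add_left_eq)
      have surj: "(\<lambda>i. (i + k) mod l) ` {..<l} = {..<l}"
      proof (intro equalityI subsetI)
        fix j assume "j \<in> {..<l}"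
        \<comment> \<open>Shifting by l - k inverts the shift by k modulo l.\<close>
        then have "j = ((j + (l - k)) mod l + k) mod l" using k by (simp add: mod_add_left_eq)
        then show "j \<in> (\<lambda>i. (i + k) mod l) ` {..<l}" by (rule image_eqI[where x = "(j + (l - k)) mod l"]) (use l in simp)
      qed (use l in auto)
      then have "inj_on (\<lambda>i. (i + k) mod l) {..<l}" by (intro eq_card_imp_inj_on) auto
      then have "inj_on (\<lambda>i. w ((i + k) mod l)) {..<l}"
        using comp_inj_on[of "\<lambda>i. (i + k) mod l" "{..<l}" w] inj surj by (simp add: o_def)
      then have "inj_on v {..<l}" using vi by (subst inj_on_cong) auto
      moreover have "v \<in> {..<l} \<rightarrow>\<^sub>E V"
        unfolding k(2) rot_def restrict_PiE_iff using PiE_mem[OF wV] l by simp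
      moreover have "cycle_arcs l v = (\<lambda>j. (w j, w (Suc j mod l))) ` (\<lambda>i. (i + k) mod l) ` {..<l}"
        unfolding cycle_arcs_def image_image by (intro image_cong refl) (auto simp: vi vS)
      then have "cycle_arcs l v = cycle_arcs l w" unfolding surj by (simp add: cycle_arcs_def)
      ultimately show "v \<in> {v \<in> ?X. cycle_arcs l v = cycle_arcs l w}"
        using w by (auto simp: cyclic_seqs_def)
    qed
    moreover have "inj_on rot {..<l}"
    proof (rule inj_onI)
      fix k k' assume kk: "k \<in> {..<l}" "k' \<in> {..<l}" "rot k = rot k'"
      then have "rot k 0 = rot k' 0" by simp
      then have "w k = w k'" using kk l by (simp add: rot_def)
      then show "k = k'" using inj kk by (auto dest: inj_onD)
    qed
    ultimately show ?thesis by (simp add: card_image)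
  qed
  have "card ?X = (\<Sum>c\<in>cycle_arcs l ` ?X. card {v \<in> ?X. cycle_arcs l v = c})"
    using sum.image_gen[OF fin, of "\<lambda>_. 1::nat" "cycle_arcs l"] by simp
  also have "\<dots> = (\<Sum>c\<in>cycle_arcs l ` ?X. l)" using fiber by (intro sum.cong refl) auto
  finally show ?thesis by (simp add: directed_cycles_eq[OF E l])
qed

lemma finite_tournaments: "finite V \<Longrightarrow> finite {E. tournament V E}"
  by (rule finite_subset[of _ "Pow (V \<times> V)"]) (auto simp: tournament_def)

lemma tournament_less: "tournament {..<n} {(i, j). i < j \<and> j < (n::nat)}"
  by (auto simp: tournament_def total_on_def intro!: asymI)

text \<open>Reversing one arc shows that every further prescribed arc halves the number of
  tournaments.\<close>

lemma card_tournaments_containing: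
  assumes V: "finite V" and "finite F" "F \<subseteq> V \<times> V" "F \<inter> F\<inverse> = {}"
  shows "card {E. tournament V E \<and> F \<subseteq> E} * 2 ^ card F = card {E. tournament V E}"
  using assms(2-)
proof (induction F rule: finite_induct)
  case empty
  then show ?case by simp
next
  case (insert a F)
  obtain p q where a: "a = (p, q)" by force
  have pq: "p \<in> V" "q \<in> V" "p \<noteq> q" "(q, p) \<notin> F" "(p, q) \<notin> F"
    using insert.prems insert.hyps a by auto
  define N1 where "N1 = {E. tournament V E \<and> insert a F \<subseteq> E}"
  define N2 where "N2 = {E. tournament V E \<and> insert (q, p) F \<subseteq> E}"
  have flip: "tournament V (insert (y, x) (E - {(x, y)}))"
    if "tournament V E" "x \<in> V" "y \<in> V" "x \<noteq> y" for E x y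
    using that unfolding tournament_def by (auto simp: total_on_def asym_iff intro!: asymI)
  have asym: "(y, x) \<notin> E" if "tournament V E" "(x, y) \<in> E" for E x y
    using that by (auto simp: tournament_def dest: asymD)
  have "bij_betw (\<lambda>E. insert (q, p) (E - {(p, q)})) N1 N2"
  proof (rule bij_betwI[where g = "\<lambda>E. insert (p, q) (E - {(q, p)})"])
    show "(\<lambda>E. insert (q, p) (E - {(p, q)})) \<in> N1 \<rightarrow> N2"
      using flip[of _ p q] pq by (auto simp: N1_def N2_def a)
    show "(\<lambda>E. insert (p, q) (E - {(q, p)})) \<in> N2 \<rightarrow> N1"
      using flip[of _ q p] pq by (auto simp: N1_def N2_def a)
    show "insert (p, q) (insert (q, p) (E - {(p, q)}) - {(q, p)}) = E" if "E \<in> N1" for E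
      using that asym[of E p q] pq by (auto simp: N1_def a)
    show "insert (q, p) (insert (p, q) (E - {(q, p)}) - {(p, q)}) = E" if "E \<in> N2" for E
      using that asym[of E q p] pq by (auto simp: N2_def)
  qed
  then have "card N1 = card N2" by (rule bij_betw_same_card)
  moreover have "{E. tournament V E \<and> F \<subseteq> E} = N1 \<union> N2"
    using pq by (auto simp: N1_def N2_def a tournament_def total_on_def)
  moreover have "N1 \<inter> N2 = {}" using asym by (auto simp: N1_def N2_def a)
  moreover have "finite N1" "finite N2"
    by (rule finite_subset[OF _ finite_tournaments[OF V]]; auto simp: N1_def N2_def)+
  ultimately have "card {E. tournament V E \<and> F \<subseteq> E} = 2 * card N1"
    by (simp add: card_Un_disjoint)
  moreover have "card {E. tournament V E \<and> F \<subseteq> E} * 2 ^ card F = card {E. tournament V E}"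
    using insert by auto
  ultimately show ?case using insert.hyps by (simp add: N1_def mult_ac)
qed

text \<open>Two opposite arcs would make two indices successors of each other modulo l, which is
  impossible for l >= 3.\<close>

lemma cycle_arcs_simple:
  assumes "inj_on v {..<l}" "l \<ge> 3"
  shows "card (cycle_arcs l v) = l" and "cycle_arcs l v \<inter> (cycle_arcs l v)\<inverse> = {}"
proof -
  have "inj_on (\<lambda>i. (v i, v (Suc i mod l))) {..<l}"
    using assms(1) by (auto simp: inj_on_def)
  then show "card (cycle_arcs l v) = l" by (simp add: cycle_arcs_def card_image)
  have False if ij: "i < l" "j < l" "v i = v (Suc j mod l)" "v j = v (Suc i mod l)" for i j
  proof -
    have "i = Suc j mod l" "j = Suc i mod l"
      using assms ij by (auto dest!: inj_onD[OF assms(1)])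
    moreover have "Suc m mod l = (if Suc m = l then 0 else Suc m)" if "m < l" for m
      using that by auto
    ultimately show False using ij assms(2) by (auto split: if_splits)
  qed
  then show "cycle_arcs l v \<inter> (cycle_arcs l v)\<inverse> = {}"
    unfolding cycle_arcs_def by (auto; metis)
qed

lemma card_injective_seqs:
  assumes "l \<le> n"
  shows "card {v \<in> {..<l} \<rightarrow>\<^sub>E {..<n}. inj_on v {..<l}} = fact l * (n choose l)"
proof -
  have "card {v \<in> {..<l} \<rightarrow>\<^sub>E {..<n}. inj_on v {..<l}} = (\<Prod>i = 0..<l. n - i)"
    using card_inj_on_subset_funcset[of "{..<l}" "{..<n}" "{..<l}"] by simp
  also have "real \<dots> = (\<Prod>i = 0..<l. real n - real i)"
    using assms by (simp add: of_nat_diff)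
  also have "\<dots> = real (fact l * (n choose l))"
    using gbinomial_mult_fact[of l "real n"] by (simp add: binomial_gbinomial)
  finally show ?thesis using of_nat_eq_iff by blast
qed

text \<open>Averaging, by contradiction: if every tournament fell short of the mean, double counting
  pairs of a tournament and a cyclic sequence in it would fail.\<close>

lemma exists_tournament_many_cycles:
  assumes "l \<ge> 3" "l \<le> n"
  shows "\<exists>E. tournament {..<n} E \<and> fact l * (n choose l) \<le> 2 ^ l * card (cyclic_seqs {..<n} E l)"
proof (rule ccontr)
  let ?T = "{E. tournament {..<n} E}"
  let ?I = "{v \<in> {..<l} \<rightarrow>\<^sub>E {..<n}. inj_on v {..<l}}"
  assume "\<not> ?thesis"
  then have less: "2 ^ l * card (cyclic_seqs {..<n} E l) < card ?I" if "E \<in> ?T" for E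
    using that card_injective_seqs[OF assms(2)] by force
  have finT: "finite ?T" by (intro finite_tournaments) simp
  have finI: "finite ?I" by (rule finite_subset[of _ "{..<l} \<rightarrow>\<^sub>E {..<n}"]) (auto intro!: finite_PiE)
  have neT: "?T \<noteq> {}" using tournament_less by blast
  have "(\<Sum>E\<in>?T. card (cyclic_seqs {..<n} E l)) = (\<Sum>E\<in>?T. \<Sum>v\<in>?I. of_bool (cycle_arcs l v \<subseteq> E))"
    by (intro sum.cong refl)
      (auto simp: of_bool_def sum.If_cases finI cyclic_seqs_def Int_def intro!: arg_cong[where f = card])
  also have "\<dots> = (\<Sum>v\<in>?I. \<Sum>E\<in>?T. of_bool (cycle_arcs l v \<subseteq> E))" by (rule sum.swap)
  also have "\<dots> = (\<Sum>v\<in>?I. card {E. tournament {..<n} E \<and> cycle_arcs l v \<subseteq> E})"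
    by (intro sum.cong refl)
      (auto simp: of_bool_def sum.If_cases finT Int_def intro!: arg_cong[where f = card])
  finally have "2 ^ l * (\<Sum>E\<in>?T. card (cyclic_seqs {..<n} E l))
      = (\<Sum>v\<in>?I. card {E. tournament {..<n} E \<and> cycle_arcs l v \<subseteq> E} * 2 ^ l)"
    by (simp add: sum_distrib_left mult.commute)
  \<comment> \<open>The l arcs are distinct and no two are opposite, so exactly one tournament in
    2^l contains all of them.\<close>
  also have "\<dots> = (\<Sum>v\<in>?I. card ?T)"
  proof (intro sum.cong refl)
    fix v assume v: "v \<in> ?I"
    have "cycle_arcs l v \<subseteq> {..<n} \<times> {..<n}" using v assms by (auto simp: cycle_arcs_def PiE_def Pi_def)
    then show "card {E. tournament {..<n} E \<and> cycle_arcs l v \<subseteq> E} * 2 ^ l = card ?T"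
      using card_tournaments_containing[of "{..<n}" "cycle_arcs l v"] cycle_arcs_simple[of v l] v assms
      by (simp add: cycle_arcs_def)
  qed
  finally have "(\<Sum>E\<in>?T. 2 ^ l * card (cyclic_seqs {..<n} E l)) = (\<Sum>E\<in>?T. card ?I)"
    by (simp add: sum_distrib_left mult.commute)
  moreover have "(\<Sum>E\<in>?T. 2 ^ l * card (cyclic_seqs {..<n} E l)) < (\<Sum>E\<in>?T. card ?I)"
    by (intro sum_strict_mono finT neT less)
  ultimately show False by simp
qed

lemma max_cycles_ge:
  assumes "tournament {..<n} E"
  shows "card (directed_cycles E l) \<le> max_cycles n l"
proof -
  have "{card (directed_cycles E l) | E. tournament {..<n} E} = (\<lambda>E. card (directed_cycles E l)) ` {E. tournament {..<n} E}"
    by auto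
  then have "finite {card (directed_cycles E l) | E. tournament {..<n} E}"
    using finite_tournaments[of "{..<n}"] by simp
  then show ?thesis unfolding max_cycles_def using assms by (intro Max_ge) auto
qed

lemma max_cycles_attained:
  "\<exists>E. tournament {..<n} E \<and> max_cycles n l = card (directed_cycles E l)"
proof -
  have "{card (directed_cycles E l) | E. tournament {..<n} E} = (\<lambda>E. card (directed_cycles E l)) ` {E. tournament {..<n} E}"
    by auto
  then have "finite {card (directed_cycles E l) | E. tournament {..<n} E}"
    "{card (directed_cycles E l) | E. tournament {..<n} E} \<noteq> {}"
    using finite_tournaments[of "{..<n}"] tournament_less[of n] by auto
  from Max_in[OF this] show ?thesis unfolding max_cycles_def by blast
qed

text \<open>Compares all sequences of length l, which the integral over the cube sees, with the
  injective ones.\<close>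

lemma power_over_falling_factorial_tendsto:
  "(\<lambda>n. real n ^ l / (fact l * real (n choose l))) \<longlonglongrightarrow> 1"
proof -
  have "(\<lambda>n. \<Prod>i<l. real n / (real n - real i)) \<longlonglongrightarrow> (\<Prod>i<l. 1)"
    by (intro tendsto_prod) real_asymp
  moreover have "real n ^ l / (fact l * real (n choose l)) = (\<Prod>i<l. real n / (real n - real i))" for n
  proof -
    have "fact l * real (n choose l) = (\<Prod>i<l. real n - real i)"
      using gbinomial_mult_fact[of l "real n"]
      by (simp add: binomial_gbinomial atLeast0LessThan)
    then show ?thesis by (simp add: prod_dividef)
  qed
  ultimately show ?thesis by simp
qed

text \<open>Passing to sequences multiplies the cycle count by l and turns
  \<open>random_cycles\<close> into 2^-l times the number of injective sequences. Averaging then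
  bounds the ratio below by 1.\<close>

lemma cycle_ratio_tendsto:
  assumes l: "l \<ge> 3"
    and upper: "\<And>n E. n > 0 \<Longrightarrow> tournament {..<n} E \<Longrightarrow> 2 ^ l * real (card (cyclic_seqs {..<n} E l)) \<le> real n ^ l"
  shows "(\<lambda>n. real (max_cycles n l) / random_cycles n l) \<longlonglongrightarrow> 1"
proof (rule tendsto_sandwich[OF _ _ tendsto_const power_over_falling_factorial_tendsto])
  have rc: "random_cycles n l = fact l * real (n choose l) / (2 ^ l * real l)" for n
    using l by (simp add: random_cycles_def fact_reduce[of l] field_simps)
  have cs: "real (card (cyclic_seqs {..<n} E l)) = real l * real (card (directed_cycles E l))"
    if "tournament {..<n} E" for n :: nat and E
    using card_cyclic_seqs[of "{..<n}" E l] that l by (simp add: tournament_def)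
  have pos: "fact l * real (n choose l) > 0" if "n \<ge> l" for n using that by simp
  have ratio: "real c / random_cycles n l = 2 ^ l * (real l * real c) / (fact l * real (n choose l))" for c n
    using l by (simp add: rc field_simps)
  show "\<forall>\<^sub>F n in sequentially. 1 \<le> real (max_cycles n l) / random_cycles n l"
    using eventually_ge_at_top[of l]
  proof eventually_elim
    case (elim n)
    from exists_tournament_many_cycles[OF l elim] obtain E where E: "tournament {..<n} E"
      and le: "fact l * (n choose l) \<le> 2 ^ l * card (cyclic_seqs {..<n} E l)" by blast
    have "fact l * real (n choose l) \<le> 2 ^ l * real (card (cyclic_seqs {..<n} E l))"
      using of_nat_mono[OF le, where 'a = real] by simp
    also have "\<dots> = 2 ^ l * (real l * real (card (directed_cycles E l)))" by (simp add: cs[OF E])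
    also have "\<dots> \<le> 2 ^ l * (real l * real (max_cycles n l))"
      using max_cycles_ge[OF E] by (intro mult_left_mono) auto
    finally show ?case unfolding ratio using pos[OF elim] by (simp add: le_divide_eq)
  qed
  show "\<forall>\<^sub>F n in sequentially. real (max_cycles n l) / random_cycles n l \<le> real n ^ l / (fact l * real (n choose l))"
    using eventually_ge_at_top[of l]
  proof eventually_elim
    case (elim n)
    from max_cycles_attained obtain E where E: "tournament {..<n} E" "max_cycles n l = card (directed_cycles E l)"
      by blast
    show ?case unfolding ratio
      by (rule divide_right_mono) (use upper[OF _ E(1)] cs[OF E(1)] E(2) elim l in auto)
  qed
qed

section \<open>Tournamentons\<close>

abbreviation unit_interval_measure :: "real measure" where
  "unit_interval_measure \<equiv> restrict_space lborel {0..1}"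

lemma prob_space_unit_interval: "prob_space unit_interval_measure"
  by (rule prob_spaceI) (simp add: space_restrict_space emeasure_restrict_space)

section \<open>Borel versions and null sets\<close>

lemma (in complete_measure) measurable_AE_eq:
  assumes f: "f \<in> M \<rightarrow>\<^sub>M N" and eq: "AE x in M. f x = g x" and g: "\<And>x. x \<in> space M \<Longrightarrow> g x \<in> space N"
  shows "g \<in> M \<rightarrow>\<^sub>M N"
proof (rule measurableI)
  fix A assume A: "A \<in> sets N"
  show "g -` A \<inter> space M \<in> sets M"
  proof (rule in_sets_AE)
    show "AE x in M. (x \<in> f -` A \<inter> space M) = (x \<in> g -` A \<inter> space M)" using eq by eventually_elim auto
    show "f -` A \<inter> space M \<in> sets M" using f A by (rule measurable_sets)
  qed simp
qed (rule g)

text \<open>Completeness supplies the measurability of \<open>f\<close>, so an integrand can be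
  exchanged for a Borel one that agrees almost everywhere.\<close>

lemma integral_completion_AE_eq:
  fixes f g :: "'a \<Rightarrow> real"
  assumes g: "g \<in> borel_measurable M" and eq: "AE x in M. f x = g x"
  shows "integral\<^sup>L (completion M) f = integral\<^sup>L M g"
proof -
  have g': "g \<in> borel_measurable (completion M)" using g by (rule measurable_completion)
  have eq': "AE x in completion M. f x = g x" using eq by (simp add: AE_completion_iff)
  have "f \<in> borel_measurable (completion M)"
    by (rule completion.measurable_AE_eq[OF g']) (use eq' in auto)
  then have "integral\<^sup>L (completion M) f = integral\<^sup>L (completion M) g"
    by (rule integral_cong_AE[OF _ g' eq'])
  then show ?thesis using integral_completion[OF g] by simp
qed

lemma tournamenton_borel_version:
  assumes W: "tournamenton W"
  obtains W' N where
    "case_prod W' \<in> borel_measurable (borel \<Otimes>\<^sub>M borel)"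
    "\<And>x y. 0 \<le> W' x y \<and> W' x y \<le> 1 \<and> W' x y + W' y x = 1"
    "N \<in> null_sets (lborel \<Otimes>\<^sub>M lborel)"
    "\<And>x y. x \<in> {0..1} \<Longrightarrow> y \<in> {0..1} \<Longrightarrow> (x, y) \<notin> N \<Longrightarrow> W x y = W' x y"
proof -
  let ?S = "{0..1::real} \<times> {0..1::real}"
  let ?f = "\<lambda>(x, y). W x y"
  have W_bd: "W x y \<in> {0..1}" and W_skew: "W x y + W y x = 1" if "x \<in> {0..1}" "y \<in> {0..1}" for x y
    using W that unfolding tournamenton_def by blast+
  have "?S \<in> sets lborel" by (simp add: borel_closed closed_Times)
  then have "?S \<in> sets lebesgue" by (rule sets_completionI_sets)
  moreover have "?f \<in> borel_measurable (lebesgue_on ?S)" using W by (simp add: tournamenton_def)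
  ultimately have "(\<lambda>p. if p \<in> ?S then ?f p else 0) \<in> borel_measurable lebesgue"
    by (intro borel_measurable_if_I)
  from completion_ex_borel_measurable_real[OF this] obtain g
    where g: "g \<in> borel_measurable lborel" "AE p in lborel. (if p \<in> ?S then ?f p else 0) = g p" by blast
  from g(1) have g_meas [measurable]: "g \<in> borel_measurable (borel \<Otimes>\<^sub>M borel)" by (simp add: borel_prod)
  from AE_E[OF g(2)] obtain N where N: "{p \<in> space lborel. \<not> (if p \<in> ?S then ?f p else 0) = g p} \<subseteq> N"
    "emeasure lborel N = 0" "N \<in> sets lborel" by blast
  then have N0: "N \<in> null_sets (lborel \<Otimes>\<^sub>M lborel)" by (simp add: lborel_prod null_sets_def)
  have fg: "W x y = g (x, y)" if "x \<in> {0..1}" "y \<in> {0..1}" "(x, y) \<notin> N" for x y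
  proof -
    have "(x, y) \<notin> {p \<in> space lborel. \<not> (if p \<in> ?S then ?f p else 0) = g p}"
      using N(1) that(3) by blast
    then show ?thesis using that(1,2) by simp
  qed
  let ?sw = "\<lambda>(x, y). (y :: real, x :: real)"
  \<comment> \<open>The formula for \<open>W'\<close> reads \<open>g\<close> at (x, y) and at (y,
    x), so the exceptional set must be closed under the swap.\<close>
  define N' where "N' = ?sw -` N"
  have N'0: "N' \<in> null_sets (lborel \<Otimes>\<^sub>M lborel)"
  proof -
    have sw [measurable]: "?sw \<in> lborel \<Otimes>\<^sub>M lborel \<rightarrow>\<^sub>M lborel \<Otimes>\<^sub>M lborel" by measurable
    have Ns: "N \<in> sets (lborel \<Otimes>\<^sub>M lborel)" using N0 by auto
    have sp: "N' = ?sw -` N \<inter> space (lborel \<Otimes>\<^sub>M lborel)" by (simp add: N'_def space_pair_measure)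
    have "emeasure (lborel \<Otimes>\<^sub>M lborel) N' = emeasure (distr (lborel \<Otimes>\<^sub>M lborel) (lborel \<Otimes>\<^sub>M lborel) ?sw) N"
      unfolding sp by (rule emeasure_distr[OF sw Ns, symmetric])
    also have "\<dots> = emeasure (lborel \<Otimes>\<^sub>M lborel) N" by (rule arg_cong[where f = "\<lambda>M. emeasure M N", OF lborel_pair.distr_pair_swap[symmetric]])
    finally show ?thesis using N0 measurable_sets[OF sw Ns] sp by (auto simp: null_sets_def)
  qed
  define c where "c r = max 0 (min 1 r)" for r :: real
  \<comment> \<open>Clamping gives values in [0, 1], and antisymmetrizing about 1/2 forces the
    tournament identity at every point. Where \<open>g\<close> agrees with \<open>W\<close> at both
    points, the result is still \<open>W\<close>.\<close>
  define W' where "W' x y = (1 + c (g (x, y)) - c (g (y, x))) / 2" for x y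
  show ?thesis
  proof (rule that[of W' "N \<union> N'"])
    have [measurable]: "c \<in> borel_measurable borel" unfolding c_def[abs_def] by measurable
    show "case_prod W' \<in> borel_measurable (borel \<Otimes>\<^sub>M borel)" unfolding W'_def[abs_def] by measurable
    have c01: "0 \<le> c r \<and> c r \<le> 1" for r by (auto simp: c_def)
    show "0 \<le> W' x y \<and> W' x y \<le> 1 \<and> W' x y + W' y x = 1" for x y
      using c01[of "g (x, y)"] c01[of "g (y, x)"] unfolding W'_def by (simp add: field_simps)
    show "N \<union> N' \<in> null_sets (lborel \<Otimes>\<^sub>M lborel)" using N0 N'0 by (rule null_sets.Un)
    show "W x y = W' x y" if "x \<in> {0..1}" "y \<in> {0..1}" "(x, y) \<notin> N \<union> N'" for x y
    proof -
      have "g (x, y) = W x y" "g (y, x) = W y x" using that fg by (auto simp: N'_def)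
      then show ?thesis using W_bd[OF that(1,2)] W_bd[OF that(2,1)] W_skew[OF that(1,2)]
        by (auto simp: W'_def c_def)
    qed
  qed
qed

lemma AE_unit_interval_sections:
  assumes "N \<in> null_sets (lborel \<Otimes>\<^sub>M (lborel :: real measure))"
  shows "AE x in lborel. AE y in (lborel :: real measure). (x, y) \<notin> N"
proof -
  show ?thesis by (rule lborel_pair.AE_pair) (rule AE_not_in[OF assms])
qed

lemma AE_unit_square:
  assumes N: "N \<in> null_sets (lborel \<Otimes>\<^sub>M lborel)"
  shows "AE p in unit_interval_measure \<Otimes>\<^sub>M unit_interval_measure. p \<notin> N"
    and "N \<inter> space (unit_interval_measure \<Otimes>\<^sub>M unit_interval_measure) \<in> sets (unit_interval_measure \<Otimes>\<^sub>M unit_interval_measure)"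
proof -
  let ?U = "unit_interval_measure"
  interpret U: prob_space ?U by (rule prob_space_unit_interval)
  interpret P: pair_sigma_finite ?U ?U ..
  have [measurable]: "(\<lambda>x. x) \<in> ?U \<rightarrow>\<^sub>M lborel" by (rule measurable_restrict_space1) simp
  have "(\<lambda>p. (fst p, snd p)) \<in> ?U \<Otimes>\<^sub>M ?U \<rightarrow>\<^sub>M lborel \<Otimes>\<^sub>M lborel" by measurable
  then have id: "(\<lambda>p. p) \<in> ?U \<Otimes>\<^sub>M ?U \<rightarrow>\<^sub>M lborel \<Otimes>\<^sub>M lborel" by simp
  from measurable_sets[OF id, of N] N
  show meas: "N \<inter> space (?U \<Otimes>\<^sub>M ?U) \<in> sets (?U \<Otimes>\<^sub>M ?U)" by auto
  have "{p \<in> space (?U \<Otimes>\<^sub>M ?U). p \<notin> N} = space (?U \<Otimes>\<^sub>M ?U) - (N \<inter> space (?U \<Otimes>\<^sub>M ?U))" by auto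
  also have "\<dots> \<in> sets (?U \<Otimes>\<^sub>M ?U)" using meas by auto
  finally show "AE p in ?U \<Otimes>\<^sub>M ?U. p \<notin> N"
  proof (rule P.AE_pair_measure)
    have "AE x in ?U. AE y in lborel. (x, y) \<notin> N"
      using AE_unit_interval_sections[OF N] by (simp add: AE_restrict_space_iff) (erule eventually_mono, simp)
    then show "AE x in ?U. AE y in ?U. (x, y) \<notin> N"
      by (rule eventually_mono) (simp add: AE_restrict_space_iff, erule eventually_mono, simp)
  qed
qed

text \<open>Two distinct coordinates have the product measure as joint law, so a null set of the
  square stays null in the cube. Distinctness is essential, as \<open>N\<close> may contain the
  diagonal.\<close>

lemma (in prob_space) AE_PiM_pair:
  assumes AE: "AE p in M \<Otimes>\<^sub>M M. p \<notin> N" and N: "N \<inter> space (M \<Otimes>\<^sub>M M) \<in> sets (M \<Otimes>\<^sub>M M)"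
    and ij: "i \<in> I" "j \<in> I" "i \<noteq> j"
  shows "AE x in Pi\<^sub>M I (\<lambda>_. M). (x i, x j) \<notin> N"
proof -
  interpret product_prob_space "\<lambda>_. M" I by unfold_locales
  let ?J = "{i, j}"
  let ?N = "N \<inter> space (M \<Otimes>\<^sub>M M)"
  note N [measurable]
  have pair [measurable]: "(\<lambda>x. (x i, x j)) \<in> Pi\<^sub>M ?J (\<lambda>_. M) \<rightarrow>\<^sub>M M \<Otimes>\<^sub>M M"
    by (intro measurable_Pair measurable_component_singleton) auto
  have meas: "(\<lambda>x. indicator ?N (x i, x j) :: ennreal) \<in> borel_measurable (Pi\<^sub>M ?J (\<lambda>_. M))"
    by measurable
  have "(\<integral>\<^sup>+x. indicator ?N (x i, x j) \<partial>Pi\<^sub>M ?J (\<lambda>_. M)) = (\<integral>\<^sup>+z. indicator ?N (fst z, snd z) \<partial>(M \<Otimes>\<^sub>M M))"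
    by (rule product_nn_integral_pair[where f = "\<lambda>a b. indicator ?N (a, b)"]) (use ij in auto)
  also have "\<dots> = emeasure (M \<Otimes>\<^sub>M M) ?N" by simp
  also have "\<dots> = 0" using AE N by (subst (asm) AE_iff_null) (auto simp: null_sets_def Int_def conj_commute)
  finally have "AE x in Pi\<^sub>M ?J (\<lambda>_. M). (indicator ?N (x i, x j) :: ennreal) = 0"
    unfolding nn_integral_0_iff_AE[OF meas] .
  moreover have "distr (Pi\<^sub>M I (\<lambda>_. M)) (Pi\<^sub>M ?J (\<lambda>_. M)) (\<lambda>x. restrict x ?J) = Pi\<^sub>M ?J (\<lambda>_. M)"
    by (rule distr_PiM_restrict_finite) (use ij in auto)
  ultimately have "AE x in distr (Pi\<^sub>M I (\<lambda>_. M)) (Pi\<^sub>M ?J (\<lambda>_. M)) (\<lambda>x. restrict x ?J). (indicator ?N (x i, x j) :: ennreal) = 0"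
    by (simp only:)
  then have "AE x in Pi\<^sub>M I (\<lambda>_. M). (indicator ?N (restrict x ?J i, restrict x ?J j) :: ennreal) = 0"
    by (subst (asm) AE_distr_iff) (use meas ij in \<open>auto intro!: measurable_restrict_subset borel_measurable_eq[of _ "Pi\<^sub>M ?J (\<lambda>_. M)", simplified]\<close>)
  then show ?thesis
    by (rule AE_mp) (use ij in \<open>auto intro!: AE_I2 simp: space_PiM space_pair_measure indicator_def split: if_splits\<close>)
qed

text \<open>Both notions are transferred to the Borel version: the density through null sets of the
  cube, regularity through almost every section. The rows of \<open>W'\<close> integrate to 1/2
  exactly where \<open>B\<close> applied to 1 vanishes.\<close>

lemma cycle_density_le_1:
  assumes W: "tournamenton W" and l: "odd l" "l \<ge> 3"
  shows "cycle_density W l \<le> 1" and "cycle_density W l = 1 \<longleftrightarrow> regular_tournamenton W"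
proof -
  let ?U = "unit_interval_measure"
  from tournamenton_borel_version[OF W] obtain W' N where
    W'_meas: "case_prod W' \<in> borel_measurable (borel \<Otimes>\<^sub>M borel)"
    and W'_bd: "\<And>x y. 0 \<le> W' x y \<and> W' x y \<le> 1 \<and> W' x y + W' y x = 1"
    and N: "N \<in> null_sets (lborel \<Otimes>\<^sub>M lborel)"
    and eq: "\<And>x y. x \<in> {0..1} \<Longrightarrow> y \<in> {0..1} \<Longrightarrow> (x, y) \<notin> N \<Longrightarrow> W x y = W' x y" by blast
  note [measurable] = W'_meas
  have U_id [measurable]: "(\<lambda>x. x) \<in> ?U \<rightarrow>\<^sub>M borel" by (rule measurable_restrict_space1) simp
  have space_U: "space ?U = {0..1}" by (simp add: space_restrict_space)
  define B where "B x y = 2 * W' x y - 1" for x y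
  interpret skew_kernel ?U B
  proof (intro skew_kernel.intro skew_kernel_axioms.intro prob_space_unit_interval)
    show "case_prod B \<in> borel_measurable (?U \<Otimes>\<^sub>M ?U)" unfolding B_def[abs_def] by measurable
    show "\<bar>B x y\<bar> \<le> 1" for x y using W'_bd[of x y] by (auto simp: B_def)
    show "B y x = - B x y" for x y using W'_bd[of x y] by (auto simp: B_def)
  qed
  have A_eq: "A x y = 2 * W' x y" for x y by (simp add: A_def B_def)
  obtain k where k: "l = Suc k" using l by (cases l) auto
  let ?P = "Pi\<^sub>M {..<l} (\<lambda>_. ?U)"
  have "AE x in ?P. (x i, x (Suc i mod l)) \<notin> N" if "i < l" for i
  proof (rule AE_PiM_pair[OF AE_unit_square[OF N]])
    show "i \<in> {..<l}" "Suc i mod l \<in> {..<l}" using that by auto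
    show "i \<noteq> Suc i mod l" using that l by (cases "Suc i = l") auto
  qed
  then have "AE x in ?P. \<forall>i\<in>{..<l}. (x i, x (Suc i mod l)) \<notin> N" by (intro AE_finite_allI) auto
  then have AE_eq: "AE x in ?P. (\<Prod>i<l. W (x i) (x (Suc i mod l))) = (\<Prod>i<l. W' (x i) (x (Suc i mod l)))"
  proof (rule AE_mp, intro AE_I2 impI prod.cong refl)
    fix x i assume "x \<in> space ?P" "\<forall>i\<in>{..<l}. (x i, x (Suc i mod l)) \<notin> N" "i \<in> {..<l}"
    then show "W (x i) (x (Suc i mod l)) = W' (x i) (x (Suc i mod l))"
      by (intro eq) (auto simp: space_PiM space_U PiE_def Pi_def)
  qed
  have comp: "(\<lambda>x. x i) \<in> ?P \<rightarrow>\<^sub>M borel" if "i < l" for i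
    by (rule measurable_compose[OF measurable_component_singleton[of i "{..<l}" "\<lambda>_. ?U"] U_id]) (use that in auto)
  have "cycle_density W l = 2 ^ l * (\<integral>x. (\<Prod>i<l. W' (x i) (x (Suc i mod l))) \<partial>?P)"
    unfolding cycle_density_def unit_cube_measure_def
    by (subst integral_completion_AE_eq[OF _ AE_eq])
      (auto intro!: borel_measurable_prod measurable_Pair_compose_split[OF W'_meas] comp)
  also have "\<dots> = (\<integral>x. 2 ^ l * (\<Prod>i<l. W' (x i) (x (Suc i mod l))) \<partial>?P)" by simp
  also have "\<dots> = (\<integral>x. (\<Prod>i<k. A (x i) (x (Suc i))) * A (x k) (x 0) \<partial>?P)"
  proof (intro Bochner_Integration.integral_cong refl)
    fix x :: "nat \<Rightarrow> real"
    have "2 ^ l * (\<Prod>i<l. W' (x i) (x (Suc i mod l))) = (\<Prod>i<l. A (x i) (x (Suc i mod l)))"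
      by (simp add: A_eq prod.distrib)
    also have "\<dots> = (\<Prod>i<k. A (x i) (x (Suc i mod l))) * A (x k) (x 0)" by (simp add: k)
    also have "(\<Prod>i<k. A (x i) (x (Suc i mod l))) = (\<Prod>i<k. A (x i) (x (Suc i)))"
      by (intro prod.cong refl) (simp add: k)
    finally show "2 ^ l * (\<Prod>i<l. W' (x i) (x (Suc i mod l))) = (\<Prod>i<k. A (x i) (x (Suc i))) * A (x k) (x 0)" .
  qed
  also have "\<dots> = kernel_trace (kernel_prod (replicate l A))"
    using cube_integral_eq_kernel_trace[OF bounded_kernel_A bounded_kernel_A, of k]
    by (simp add: k replicate_append_same)
  also have "\<dots> = cycle_moment moment l" by (rule kernel_trace_eq_cycle_moment[OF l])
  finally have cd: "cycle_density W l = cycle_moment moment l" .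
  show "cycle_density W l \<le> 1" unfolding cd by (rule cycle_moment_le_1(1)[OF l])
  \<comment> \<open>For almost every x the section of \<open>N\<close> at x is null, which makes the
    Lebesgue integral of W over y a Borel integral of \<open>W'\<close>.\<close>
  have sections: "AE x in ?U. (LINT y|lebesgue_on {0..1}. W x y) = (LINT y|?U. W' x y)"
  proof -
    have "AE x in ?U. AE y in lborel. (x, y) \<notin> N"
      using AE_unit_interval_sections[OF N] by (simp add: AE_restrict_space_iff) (erule AE_mp, simp)
    then show ?thesis
    proof (rule AE_mp, intro AE_I2 impI)
      fix x assume x: "x \<in> space ?U" and AEy: "AE y in lborel. (x, y) \<notin> N"
      have "(LINT y|lebesgue_on {0..1}. W x y) = (LINT y|lebesgue. indicator {0..1} y *\<^sub>R W x y)"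
        by (rule integral_restrict_space) simp
      also have "\<dots> = (LINT y|lborel. indicator {0..1} y *\<^sub>R W' x y)"
      proof (rule integral_completion_AE_eq)
        have "(\<lambda>y. W' x y) \<in> borel_measurable borel"
          by (rule measurable_Pair_compose_split[OF W'_meas]) simp_all
        then show "(\<lambda>y. indicator {0..1} y *\<^sub>R W' x y) \<in> borel_measurable lborel"
          by (intro borel_measurable_scaleR borel_measurable_indicator) simp_all
        show "AE y in lborel. indicator {0..1} y *\<^sub>R W x y = indicator {0..1} y *\<^sub>R W' x y"
          using AEy by (rule AE_mp) (use x in \<open>auto intro!: AE_I2 eq simp: indicator_def space_U\<close>)
      qed
      also have "\<dots> = (LINT y|?U. W' x y)"
        by (rule integral_restrict_space[symmetric]) simp
      finally show "(LINT y|lebesgue_on {0..1}. W x y) = (LINT y|?U. W' x y)" .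
    qed
  qed
  have app: "kernel_app B (\<lambda>_. 1) x = 2 * (LINT y|?U. W' x y) - 1" if x: "x \<in> space ?U" for x
  proof -
    have "bounded_kernel W'"
    proof (rule bounded_kernelI[of _ 1])
      show "case_prod W' \<in> borel_measurable (?U \<Otimes>\<^sub>M ?U)" by measurable
      show "\<bar>W' x y\<bar> \<le> 1" for x y using W'_bd[of x y] by simp
    qed
    then have "integrable ?U (W' x)"
      using x by (intro bounded_fun_integrable bounded_kernel_section(1))
    then show ?thesis using prob_space[unfolded space_U] by (simp add: kernel_app_def B_def)
  qed
  have "regular_tournamenton W \<longleftrightarrow> (AE x in ?U. (LINT y|lebesgue_on {0..1}. W x y) = 1 / 2)"
    unfolding regular_tournamenton_def by (simp add: AE_restrict_space_iff AE_completion_iff)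
  also have "\<dots> \<longleftrightarrow> (AE x in ?U. kernel_app B (\<lambda>_. 1) x = 0)"
  proof
    assume "AE x in ?U. (LINT y|lebesgue_on {0..1}. W x y) = 1 / 2"
    with sections AE_space show "AE x in ?U. kernel_app B (\<lambda>_. 1) x = 0"
      by eventually_elim (simp add: app)
  next
    assume "AE x in ?U. kernel_app B (\<lambda>_. 1) x = 0"
    with sections AE_space show "AE x in ?U. (LINT y|lebesgue_on {0..1}. W x y) = 1 / 2"
      by eventually_elim (simp add: app)
  qed
  finally show "cycle_density W l = 1 \<longleftrightarrow> regular_tournamenton W"
    unfolding cd using cycle_moment_le_1(2)[OF l] by simp
qed

text \<open>The comparison \<open>a < b\<close> only matters when one of the labels is the number of vertices, that is,
  at the end point 1 of the interval.\<close>

definition step_weight :: "(nat \<times> nat) set \<Rightarrow> nat \<Rightarrow> nat \<Rightarrow> real" where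
  "step_weight E a b = (if a = b then 1 / 2 else if (a, b) \<in> E \<or> (b, a) \<notin> E \<and> a < b then 1 else 0)"

definition step_kernel :: "nat \<Rightarrow> (nat \<times> nat) set \<Rightarrow> real \<Rightarrow> real \<Rightarrow> real" where
  "step_kernel n E x y = step_weight E (nat \<lfloor>real n * x\<rfloor>) (nat \<lfloor>real n * y\<rfloor>)"

lemma step_kernel_measurable: "case_prod (step_kernel n E) \<in> borel_measurable (borel \<Otimes>\<^sub>M borel)"
proof -
  have [measurable]: "case_prod (step_weight E) \<in> borel_measurable (count_space UNIV \<Otimes>\<^sub>M count_space UNIV)"
    by (simp add: pair_measure_countable)
  show ?thesis unfolding step_kernel_def[abs_def] by measurable
qed

lemma tournamenton_step_kernel:
  assumes "tournament V E"
  shows "tournamenton (step_kernel n E)"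
proof -
  have "(\<lambda>(x, y). step_kernel n E x y) \<in> borel_measurable lborel"
    using step_kernel_measurable[of n E] by (simp add: borel_prod)
  then have "(\<lambda>(x, y). step_kernel n E x y) \<in> borel_measurable (lebesgue_on ({0..1} \<times> {0..1}))"
    by (intro measurable_restrict_space1 measurable_completion)
  moreover have "(a, b) \<in> E \<Longrightarrow> (b, a) \<notin> E" for a b
    using assms by (auto simp: tournament_def dest: asymD)
  then have "step_weight E a b \<in> {0..1} \<and> step_weight E a b + step_weight E b a = 1" for a b
    unfolding step_weight_def by (cases "a < b"; cases "(a, b) \<in> E"; cases "(b, a) \<in> E") auto
  ultimately show ?thesis
    unfolding tournamenton_def step_kernel_def by blast
qed

text \<open>Each cyclic sequence owns a box of volume n^-l on which the integrand of the step
  tournamenton is 1. The boxes are disjoint and the integrand is nonnegative, so the density bound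
  limits their number; tuples with repeated vertices are simply dropped.\<close>

lemma card_cyclic_seqs_le:
  assumes n: "n > 0" and E: "tournament {..<n} E" and l: "odd l" "l \<ge> 3"
  shows "2 ^ l * real (card (cyclic_seqs {..<n} E l)) \<le> real n ^ l"
proof -
  let ?U = "unit_interval_measure"
  let ?P = "Pi\<^sub>M {..<l} (\<lambda>_. ?U)"
  let ?X = "cyclic_seqs {..<n} E l"
  interpret U: prob_space ?U by (rule prob_space_unit_interval)
  interpret P: prob_space ?P by (rule prob_space_PiM) (rule prob_space_unit_interval)
  interpret psf: product_sigma_finite "\<lambda>_::nat. ?U" by unfold_locales
  define F where "F x = (\<Prod>i<l. step_kernel n E (x i) (x (Suc i mod l)))" for x :: "nat \<Rightarrow> real"
  \<comment> \<open>Half-open intervals, so that the floor in \<open>step_kernel\<close> recovers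
    the label exactly and cells with different labels are disjoint.\<close>
  define cell where "cell a = {real a / real n ..< (real a + 1) / real n}" for a :: nat
  define box where "box v = Pi\<^sub>E {..<l} (\<lambda>i. cell (v i))" for v :: "nat \<Rightarrow> nat"
  have fin: "finite ?X"
    by (rule finite_subset[of _ "{..<l} \<rightarrow>\<^sub>E {..<n}"]) (auto simp: cyclic_seqs_def intro!: finite_PiE)
  have floor: "nat \<lfloor>real n * r\<rfloor> = a" if "r \<in> cell a" for r a
  proof -
    have "real a \<le> real n * r" "real n * r < real a + 1" using that n by (auto simp: cell_def field_simps)
    then have "\<lfloor>real n * r\<rfloor> = int a" by (simp add: floor_eq_iff)
    then show ?thesis by simp
  qed
  have cell_sub: "cell a \<subseteq> {0..1}" if "a < n" for a
  proof
    fix r assume "r \<in> cell a"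
    then have "real a / real n \<le> r" "r < (real a + 1) / real n" by (auto simp: cell_def)
    moreover have "(real a + 1) / real n \<le> 1" using that by (simp add: field_simps)
    moreover have "0 \<le> real a / real n" by simp
    ultimately have "0 \<le> r" "r \<le> 1" by linarith+
    then show "r \<in> {0..1}" by simp
  qed
  have cell_sets: "cell a \<in> sets ?U" if "a < n" for a
    using cell_sub[OF that] by (subst sets_restrict_space_iff) (auto simp: cell_def)
  have cell_meas: "emeasure ?U (cell a) = ennreal (1 / real n)" if "a < n" for a
  proof -
    have "emeasure ?U (cell a) = emeasure lborel (cell a)"
      using cell_sub[OF that] by (intro emeasure_restrict_space) auto
    also have "\<dots> = ennreal ((real a + 1) / real n - real a / real n)"
      unfolding cell_def using n by (subst emeasure_lborel_Ico) (auto simp: field_simps)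
    also have "(real a + 1) / real n - real a / real n = 1 / real n" by (simp add: diff_divide_distrib[symmetric])
    finally show ?thesis .
  qed
  have vn: "v i < n" if "v \<in> ?X" "i < l" for v i using that by (auto simp: cyclic_seqs_iff)
  have box_sets: "box v \<in> sets ?P" if "v \<in> ?X" for v
    unfolding box_def using vn[OF that] by (intro sets_PiM_I_finite cell_sets) auto
  have box_meas: "measure ?P (box v) = (1 / real n) ^ l" if "v \<in> ?X" for v
  proof -
    have "emeasure ?P (box v) = (\<Prod>i<l. emeasure ?U (cell (v i)))"
      unfolding box_def using vn[OF that] by (intro psf.emeasure_PiM cell_sets) auto
    also have "\<dots> = (\<Prod>i<l. ennreal (1 / real n))" using vn[OF that] by (intro prod.cong refl cell_meas) auto
    also have "\<dots> = ennreal ((1 / real n) ^ l)" by (simp add: ennreal_power)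
    finally show ?thesis by (simp add: measure_def)
  qed
  have box_mem: "x i \<in> cell (v i)" if "x \<in> box v" "i < l" for x v i
    using PiE_mem[OF that(1)[unfolded box_def], of i] that(2) by simp
  have F_bd: "0 \<le> F x" "F x \<le> 1" for x
    unfolding F_def by (auto intro!: prod_nonneg prod_le_1 simp: step_kernel_def step_weight_def)
  have F_1: "F x = 1" if v: "v \<in> ?X" and x: "x \<in> box v" for v x
  proof -
    have "step_kernel n E (x i) (x (Suc i mod l)) = 1" if i: "i < l" for i
    proof -
      have j: "Suc i mod l < l" using i by simp
      have "x i \<in> cell (v i)" "x (Suc i mod l) \<in> cell (v (Suc i mod l))"
        using box_mem[OF x i] box_mem[OF x j] .
      then have fl: "nat \<lfloor>real n * x i\<rfloor> = v i" "nat \<lfloor>real n * x (Suc i mod l)\<rfloor> = v (Suc i mod l)"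
        using floor by metis+
      have "i \<noteq> Suc i mod l" using i l by (cases "Suc i = l") auto
      moreover have "inj_on v {..<l}" using v by (simp add: cyclic_seqs_iff)
      ultimately have "v i \<noteq> v (Suc i mod l)" using i j by (simp add: inj_on_eq_iff)
      moreover have "(v i, v (Suc i mod l)) \<in> E" using v i by (simp add: cyclic_seqs_iff)
      ultimately show ?thesis by (simp add: step_kernel_def step_weight_def fl)
    qed
    then show ?thesis unfolding F_def by simp
  qed
  have box_unique: "v = w" if "v \<in> ?X" "w \<in> ?X" "x \<in> box v" "x \<in> box w" for v w x
  proof (rule extensionalityI[of _ "{..<l}"])
    show "v i = w i" if "i \<in> {..<l}" for i
    proof -
      have "x i \<in> cell (v i)" "x i \<in> cell (w i)"
        using box_mem[of x v i] box_mem[of x w i] \<open>x \<in> box v\<close> \<open>x \<in> box w\<close> that by simp_all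
      then show ?thesis using floor by metis
    qed
  qed (use that in \<open>auto simp: cyclic_seqs_iff PiE_def\<close>)
  have sum_le: "(\<Sum>v\<in>?X. indicator (box v) x) \<le> F x" for x
  proof (cases "\<exists>v\<in>?X. x \<in> box v")
    case True
    then obtain v where v: "v \<in> ?X" "x \<in> box v" by blast
    have "(\<Sum>w\<in>?X. indicator (box w) x) = (\<Sum>w\<in>{v}. indicator (box w) x :: real)"
      using v fin box_unique by (intro sum.mono_neutral_right) (auto simp: indicator_def)
    then show ?thesis using v F_1 by simp
  next
    case False
    then have "(\<Sum>w\<in>?X. indicator (box w) x) = (0::real)" by (intro sum.neutral) (auto simp: indicator_def)
    then show ?thesis using F_bd by simp
  qed
  have U_id: "(\<lambda>x. x) \<in> ?U \<rightarrow>\<^sub>M borel" by (rule measurable_restrict_space1) simp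
  have comp: "(\<lambda>x. x i) \<in> ?P \<rightarrow>\<^sub>M borel" if "i < l" for i
    by (rule measurable_compose[OF measurable_component_singleton[of i "{..<l}" "\<lambda>_. ?U"] U_id]) (use that in auto)
  have F_meas: "F \<in> borel_measurable ?P"
    unfolding F_def[abs_def]
    by (intro borel_measurable_prod measurable_Pair_compose_split[OF step_kernel_measurable] comp) auto
  have "real (card ?X) * (1 / real n) ^ l = (\<Sum>v\<in>?X. measure ?P (box v))"
    using box_meas by simp
  also have "\<dots> = (\<integral>x. (\<Sum>v\<in>?X. indicator (box v) x) \<partial>?P)"
    using box_sets by (subst Bochner_Integration.integral_sum) (auto intro!: sum.cong simp: P.emeasure_eq_measure)
  also have "\<dots> \<le> (\<integral>x. F x \<partial>?P)"
  proof (rule integral_mono)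
    show "integrable ?P (\<lambda>x. \<Sum>v\<in>?X. indicator (box v) x :: real)"
      using box_sets by (intro Bochner_Integration.integrable_sum integrable_real_indicator) (auto simp: P.emeasure_eq_measure)
    show "integrable ?P F" using F_meas F_bd by (intro P.integrable_const_bound[of _ 1]) auto
  qed (rule sum_le)
  also have "\<dots> = (\<integral>x. F x \<partial>unit_cube_measure l)"
    unfolding unit_cube_measure_def by (rule integral_completion[OF F_meas, symmetric])
  finally have "2 ^ l * (real (card ?X) * (1 / real n) ^ l) \<le> cycle_density (step_kernel n E) l"
    unfolding cycle_density_def F_def by simp
  also have "\<dots> \<le> 1" by (rule cycle_density_le_1(1)[OF tournamenton_step_kernel[OF E] l])
  finally show ?thesis using n by (simp add: power_one_over field_simps)
qed

theorem theorem11: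
  fixes l :: nat
  assumes "l \<ge> 3" and "odd l"
  shows "(\<forall>W. tournamenton W \<longrightarrow>
            cycle_density W l \<le> 1 \<and> (cycle_density W l = 1 \<longleftrightarrow> regular_tournamenton W)) \<and>
         (\<lambda>n. real (max_cycles n l) / random_cycles n l) \<longlonglongrightarrow> cycle_constant l \<and>
         cycle_constant l = 1"
proof -
  have "(\<lambda>n. real (max_cycles n l) / random_cycles n l) \<longlonglongrightarrow> 1"
    by (rule cycle_ratio_tendsto) (use assms card_cyclic_seqs_le in auto)
  moreover from this have "cycle_constant l = 1"
    unfolding cycle_constant_def by (rule limI)
  ultimately show ?thesis using cycle_density_le_1 assms by auto
qed

end
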